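(* Let $\mathfrak{g}$ be a $4$-dimensional real Lie algebra with $B\wedge B=0$ (i.e. $u\wedge w=0$ in $\Lambda^4(\mathfrak{g})$ for all $u,w\in B$), where $B\subset\Lambda^2(\mathfrak{g})$ is the space of boundary $2$-vectors. Then an almost complex structure $J$ on $\mathfrak{g}$ is tamed if and only if $J$ is almost Kähler.
   Context: $\Lambda^k(\mathfrak{g})$ and $\Lambda^k(\mathfrak{g}^* )$ denote the spaces of $k$-vectors and $k$-forms on $\mathfrak{g}$, with evaluation pairing $\alpha(v_1\wedge\dots\wedge v_k)=\alpha(v_1,\dots,v_k)$. The Chevalley–Eilenberg differential $d$ on $\Lambda^*(\mathfrak{g}^* )$ is determined by $d\phi(u,v)=-\phi([u,v])$ on $1$-forms and the Leibniz rule. A $2$-vector $u$ is a boundary if there is $w\in\Lambda^3(\mathfrak{g})$ with $\varphi(u)=(d\varphi)(w)$ for all $\varphi\in\Lambda^2(\mathfrak{g}^* )$. An almost complex structure on $\mathfrak{g}$ is a linear automorphism $J$ of the vector space $\mathfrak{g}$ with $J^2=-\mathrm{id}$; $\mathfrak{g}$ carries the orientation induced by $J$. $\Lambda_J^{\pm}(\mathfrak{g}^* )$ are the $\pm1$-eigenspaces of the involution $\alpha(\cdot,\cdot)\mapsto\alpha(J\cdot,J\cdot)$ on $\Lambda^2(\mathfrak{g}^* )$. A closed $2$-form $\varphi$ on $\mathfrak{g}$ is $J$-tamed if $\varphi(v\wedge Jv)>0$ for every nonzero $v\in\mathfrak{g}$; it is $J$-compatible if in addition $\varphi\in\Lambda_J^+(\mathfrak{g}^*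 )$. $J$ is tamed if there exists a $J$-tamed form, and almost Kähler if there exists a $J$-compatible form. *)

theory Defs
  imports "HOL-Analysis.Analysis"
begin

section \<open>Exterior powers\<close>

text \<open>\<open>('a, 'k) kform\<close> is \<open>\<Lambda>\<^sup>k(V\<^sup>*)\<close> for the real vector space \<open>V\<close> = \<open>'a\<close> and \<open>k = CARD('k)\<close>: the
  alternating multilinear functions of \<open>k\<close> arguments.\<close>

definition alternating_form :: "('a::real_vector ^ 'k \<Rightarrow> real) \<Rightarrow> bool" where
  "alternating_form f \<longleftrightarrow>
     (\<forall>x i. linear (\<lambda>v. f (\<chi> j. if j = i then v else x $ j))) \<and>
     (\<forall>x i j. i \<noteq> j \<longrightarrow> x $ i = x $ j \<longrightarrow> f x = 0)"

typedef (overloaded) ('a::real_vector, 'k::finite) kform =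
  "{f :: 'a ^ 'k \<Rightarrow> real. alternating_form f}"
  morphisms form_at Abs_kform
  by (rule exI[of _ "\<lambda>_. 0"]) (simp add: alternating_form_def linear_iff)

setup_lifting type_definition_kform

instantiation kform :: (real_vector, finite) real_vector
begin

lift_definition zero_kform :: "('a, 'b) kform" is "\<lambda>_. 0"
  by (simp add: alternating_form_def linear_iff)
lift_definition plus_kform :: "('a, 'b) kform \<Rightarrow> ('a, 'b) kform \<Rightarrow> ('a, 'b) kform"
  is "\<lambda>f g x. f x + g x"
  by (auto simp: alternating_form_def linear_iff algebra_simps)
lift_definition minus_kform :: "('a, 'b) kform \<Rightarrow> ('a, 'b) kform \<Rightarrow> ('a, 'b) kform"
  is "\<lambda>f g x. f x - g x"
  by (auto simp: alternating_form_def linear_iff algebra_simps)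
lift_definition uminus_kform :: "('a, 'b) kform \<Rightarrow> ('a, 'b) kform" is "\<lambda>f x. - f x"
  by (auto simp: alternating_form_def linear_iff algebra_simps)
lift_definition scaleR_kform :: "real \<Rightarrow> ('a, 'b) kform \<Rightarrow> ('a, 'b) kform" is "\<lambda>r f x. r * f x"
  by (auto simp: alternating_form_def linear_iff algebra_simps)

instance
  by standard (transfer; simp add: algebra_simps fun_eq_iff)+

end

text \<open>In finite dimension \<open>\<Lambda>\<^sup>k(V)\<close> is the dual of \<open>\<Lambda>\<^sup>k(V\<^sup>*)\<close> under the evaluation pairing, with
  \<open>v\<^sub>1 \<and> \<dots> \<and> v\<^sub>k\<close> acting as \<open>\<alpha> \<mapsto> \<alpha>(v\<^sub>1, \<dots>, v\<^sub>k)\<close>; we take this as the definition. The decomposable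
  vectors span, see \<open>span_decomposable\<close> below.\<close>

typedef (overloaded) ('a::real_vector, 'k::finite) kvector =
  "{u :: ('a, 'k) kform \<Rightarrow> real. linear u}"
  morphisms vec_at Abs_kvector
  by (rule exI[of _ "\<lambda>_. 0"]) (simp add: linear_iff)

setup_lifting type_definition_kvector

instantiation kvector :: (real_vector, finite) real_vector
begin

lift_definition zero_kvector :: "('a, 'b) kvector" is "\<lambda>_. 0"
  by (simp add: linear_iff)
lift_definition plus_kvector :: "('a, 'b) kvector \<Rightarrow> ('a, 'b) kvector \<Rightarrow> ('a, 'b) kvector"
  is "\<lambda>f g x. f x + g x"
  by (auto simp: linear_iff algebra_simps)
lift_definition minus_kvector :: "('a, 'b) kvector \<Rightarrow> ('a, 'b) kvector \<Rightarrow> ('a, 'b) kvector"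
  is "\<lambda>f g x. f x - g x"
  by (auto simp: linear_iff algebra_simps)
lift_definition uminus_kvector :: "('a, 'b) kvector \<Rightarrow> ('a, 'b) kvector" is "\<lambda>f x. - f x"
  by (auto simp: linear_iff algebra_simps)
lift_definition scaleR_kvector :: "real \<Rightarrow> ('a, 'b) kvector \<Rightarrow> ('a, 'b) kvector"
  is "\<lambda>r f x. r * f x"
  by (auto simp: linear_iff algebra_simps)

instance
  by standard (transfer; simp add: algebra_simps fun_eq_iff)+

end

definition pairing :: "('a::real_vector, 'k::finite) kform \<Rightarrow> ('a, 'k) kvector \<Rightarrow> real" where
  "pairing \<alpha> u = vec_at u \<alpha>"

definition decomposable :: "'a::real_vector ^ 'k::finite \<Rightarrow> ('a, 'k) kvector" where
  "decomposable x = Abs_kvector (\<lambda>\<alpha>. form_at \<alpha> x)"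

lemma pairing_decomposable: "pairing \<alpha> (decomposable x) = form_at \<alpha> x"
  unfolding pairing_def decomposable_def
  by (subst Abs_kvector_inverse) (auto simp: linear_iff plus_kform.rep_eq scaleR_kform.rep_eq)

lemma linear_pairing_left: "linear (\<lambda>\<alpha>. pairing \<alpha> u)"
  using vec_at[of u] by (simp add: pairing_def)

lemma linear_pairing_right: "linear (\<lambda>u. pairing \<alpha> u)"
  by (auto simp: linear_iff pairing_def plus_kvector.rep_eq scaleR_kvector.rep_eq)

lemma kvector_eqI: "(\<And>\<alpha>. pairing \<alpha> u = pairing \<alpha> w) \<Longrightarrow> u = w"
  by (auto simp: pairing_def vec_at_inject[symmetric] fun_eq_iff)

lemma kform_eqI: "(\<And>x. form_at \<alpha> x = form_at \<beta> x) \<Longrightarrow> \<alpha> = \<beta>"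
  by transfer auto

lemmas form_at_simps =
  zero_kform.rep_eq plus_kform.rep_eq minus_kform.rep_eq uminus_kform.rep_eq scaleR_kform.rep_eq

lemma form_at_sum: "form_at (sum f A) x = (\<Sum>i\<in>A. form_at (f i) x)"
  by (induction A rule: infinite_finite_induct) (auto simp: form_at_simps)

subsection \<open>Tuples of small length\<close>

lemma vector_4 [simp]:
  "(vector [a, b, c, d] :: 'a::zero ^ 4) $ 1 = a"
  "(vector [a, b, c, d] :: 'a::zero ^ 4) $ 2 = b"
  "(vector [a, b, c, d] :: 'a::zero ^ 4) $ 3 = c"
  "(vector [a, b, c, d] :: 'a::zero ^ 4) $ 4 = d"
  unfolding vector_def by simp_all

lemma vector_eta:
  "vector [y $ 1] = (y :: 'a::zero ^ 1)"
  "vector [x $ 1, x $ 2] = (x :: 'a ^ 2)"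
  "vector [z $ 1, z $ 2, z $ 3] = (z :: 'a ^ 3)"
  "vector [w $ 1, w $ 2, w $ 3, w $ 4] = (w :: 'a ^ 4)"
  by (simp_all add: vec_eq_iff forall_1 forall_2 forall_3 forall_4)

lemma form1_linear:
  fixes \<alpha> :: "('a::real_vector, 1) kform"
  shows "linear (\<lambda>a. form_at \<alpha> (vector [a]))"
proof -
  have "linear (\<lambda>v. form_at \<alpha> (\<chi> j. if j = 1 then v else (0::'a^1) $ j))"
    using form_at[of \<alpha>] by (simp only: alternating_form_def mem_Collect_eq)
  moreover have "(\<chi> j. if j = 1 then v else (0::'a^1) $ j) = vector [v]" for v
    by (simp add: vec_eq_iff forall_1)
  ultimately show ?thesis by simp
qed

lemma form2_linear:
  fixes \<alpha> :: "('a::real_vector, 2) kform"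
  shows "linear (\<lambda>a. form_at \<alpha> (vector [a, b]))" "linear (\<lambda>b. form_at \<alpha> (vector [a, b]))"
proof -
  have *: "linear (\<lambda>v. form_at \<alpha> (\<chi> j. if j = i then v else x $ j))" for x and i :: 2
    using form_at[of \<alpha>] by (simp only: alternating_form_def mem_Collect_eq)
  have "(\<chi> j. if j = 1 then v else (vector [a, b] :: 'a^2) $ j) = vector [v, b]"
    "(\<chi> j. if j = 2 then v else (vector [a, b] :: 'a^2) $ j) = vector [a, v]" for v
    by (simp_all add: vec_eq_iff forall_2)
  then show "linear (\<lambda>a. form_at \<alpha> (vector [a, b]))" "linear (\<lambda>b. form_at \<alpha> (vector [a, b]))"
    using *[of 1 "vector [a, b]"] *[of 2 "vector [a, b]"] by simp_all
qed

lemma form3_linear: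
  fixes \<alpha> :: "('a::real_vector, 3) kform"
  shows "linear (\<lambda>a. form_at \<alpha> (vector [a, b, c]))" "linear (\<lambda>b. form_at \<alpha> (vector [a, b, c]))"
    "linear (\<lambda>c. form_at \<alpha> (vector [a, b, c]))"
proof -
  have *: "linear (\<lambda>v. form_at \<alpha> (\<chi> j. if j = i then v else x $ j))" for x and i :: 3
    using form_at[of \<alpha>] by (simp only: alternating_form_def mem_Collect_eq)
  have "(\<chi> j. if j = 1 then v else (vector [a, b, c] :: 'a^3) $ j) = vector [v, b, c]"
    "(\<chi> j. if j = 2 then v else (vector [a, b, c] :: 'a^3) $ j) = vector [a, v, c]"
    "(\<chi> j. if j = 3 then v else (vector [a, b, c] :: 'a^3) $ j) = vector [a, b, v]" for v
    by (simp_all add: vec_eq_iff forall_3)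
  then show "linear (\<lambda>a. form_at \<alpha> (vector [a, b, c]))"
    "linear (\<lambda>b. form_at \<alpha> (vector [a, b, c]))"
    "linear (\<lambda>c. form_at \<alpha> (vector [a, b, c]))"
    using *[of 1 "vector [a, b, c]"] *[of 2 "vector [a, b, c]"] *[of 3 "vector [a, b, c]"]
    by simp_all
qed

lemma form4_linear:
  fixes \<alpha> :: "('a::real_vector, 4) kform"
  shows "linear (\<lambda>a. form_at \<alpha> (vector [a, b, c, d]))"
    "linear (\<lambda>b. form_at \<alpha> (vector [a, b, c, d]))"
    "linear (\<lambda>c. form_at \<alpha> (vector [a, b, c, d]))"
    "linear (\<lambda>d. form_at \<alpha> (vector [a, b, c, d]))"
proof -
  have *: "linear (\<lambda>v. form_at \<alpha> (\<chi> j. if j = i then v else x $ j))" for x and i :: 4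
    using form_at[of \<alpha>] by (simp only: alternating_form_def mem_Collect_eq)
  have "(\<chi> j. if j = 1 then v else (vector [a, b, c, d] :: 'a^4) $ j) = vector [v, b, c, d]"
    "(\<chi> j. if j = 2 then v else (vector [a, b, c, d] :: 'a^4) $ j) = vector [a, v, c, d]"
    "(\<chi> j. if j = 3 then v else (vector [a, b, c, d] :: 'a^4) $ j) = vector [a, b, v, d]"
    "(\<chi> j. if j = 4 then v else (vector [a, b, c, d] :: 'a^4) $ j) = vector [a, b, c, v]" for v
    by (simp_all add: vec_eq_iff forall_4)
  then show "linear (\<lambda>a. form_at \<alpha> (vector [a, b, c, d]))"
    "linear (\<lambda>b. form_at \<alpha> (vector [a, b, c, d]))"
    "linear (\<lambda>c. form_at \<alpha> (vector [a, b, c, d]))"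
    "linear (\<lambda>d. form_at \<alpha> (vector [a, b, c, d]))"
    using *[of 1 "vector [a, b, c, d]"] *[of 2 "vector [a, b, c, d]"]
      *[of 3 "vector [a, b, c, d]"] *[of 4 "vector [a, b, c, d]"]
    by simp_all
qed

lemma form_eq_0: "i \<noteq> j \<Longrightarrow> x $ i = x $ j \<Longrightarrow> form_at \<alpha> x = 0"
  using form_at[of \<alpha>] by (auto simp: alternating_form_def)

lemma form2_alt: "form_at \<alpha> (vector [a, a] :: 'a::real_vector ^ 2) = 0"
  by (rule form_eq_0[of 1 2]) auto

lemma form3_alt:
  fixes \<alpha> :: "('a::real_vector, 3) kform"
  shows "form_at \<alpha> (vector [a, a, b]) = 0" "form_at \<alpha> (vector [a, b, a]) = 0"
    "form_at \<alpha> (vector [b, a, a]) = 0"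
  using form_eq_0[of 1 2 "vector [a, a, b]" \<alpha>] form_eq_0[of 1 3 "vector [a, b, a]" \<alpha>]
    form_eq_0[of 2 3 "vector [b, a, a]" \<alpha>]
  by simp_all

lemma form4_alt:
  fixes \<alpha> :: "('a::real_vector, 4) kform"
  shows "form_at \<alpha> (vector [a, a, b, c]) = 0" "form_at \<alpha> (vector [a, b, a, c]) = 0"
    "form_at \<alpha> (vector [a, b, c, a]) = 0" "form_at \<alpha> (vector [b, a, a, c]) = 0"
    "form_at \<alpha> (vector [b, a, c, a]) = 0" "form_at \<alpha> (vector [b, c, a, a]) = 0"
  using form_eq_0[of 1 2 "vector [a, a, b, c]" \<alpha>] form_eq_0[of 1 3 "vector [a, b, a, c]" \<alpha>]
    form_eq_0[of 1 4 "vector [a, b, c, a]" \<alpha>] form_eq_0[of 2 3 "vector [b, a, a, c]" \<alpha>]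
    form_eq_0[of 2 4 "vector [b, a, c, a]" \<alpha>] form_eq_0[of 3 4 "vector [b, c, a, a]" \<alpha>]
  by simp_all

lemma form2_swap:
  fixes \<alpha> :: "('a::real_vector, 2) kform"
  shows "form_at \<alpha> (vector [b, a]) = - form_at \<alpha> (vector [a, b])"
  using form2_alt[of \<alpha> "a + b"] form2_alt[of \<alpha> a] form2_alt[of \<alpha> b]
  by (simp add: linear_add[OF form2_linear(1)] linear_add[OF form2_linear(2)])

lemma alternating_form_2I:
  fixes f :: "'a::real_vector \<Rightarrow> 'a \<Rightarrow> real"
  assumes "\<And>b. linear (\<lambda>a. f a b)" "\<And>a. linear (\<lambda>b. f a b)" "\<And>a. f a a = 0"
  shows "alternating_form (\<lambda>x :: 'a^2. f (x $ 1) (x $ 2))"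
  unfolding alternating_form_def using assms by (auto simp: forall_2)

lemma alternating_form_3I:
  fixes f :: "'a::real_vector \<Rightarrow> 'a \<Rightarrow> 'a \<Rightarrow> real"
  assumes "\<And>b c. linear (\<lambda>a. f a b c)" "\<And>a c. linear (\<lambda>b. f a b c)"
    "\<And>a b. linear (\<lambda>c. f a b c)"
    "\<And>a b. f a a b = 0" "\<And>a b. f a b a = 0" "\<And>a b. f b a a = 0"
  shows "alternating_form (\<lambda>x :: 'a^3. f (x $ 1) (x $ 2) (x $ 3))"
  unfolding alternating_form_def using assms by (auto simp: forall_3)

subsection \<open>Wedge products of forms\<close>

text \<open>The normalisation is \<open>(\<alpha>\<^sub>1 \<and> \<dots> \<and> \<alpha>\<^sub>k)(v\<^sub>1, \<dots>, v\<^sub>k) = det (\<alpha>\<^sub>i(v\<^sub>j))\<close>; the suffixes are the degrees of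
  the factors.\<close>

definition fwedge11 :: "('a::real_vector, 1) kform \<Rightarrow> ('a, 1) kform \<Rightarrow> ('a, 2) kform" where
  "fwedge11 \<alpha> \<beta> = Abs_kform (\<lambda>x.
     form_at \<alpha> (vector [x $ 1]) * form_at \<beta> (vector [x $ 2])
   - form_at \<alpha> (vector [x $ 2]) * form_at \<beta> (vector [x $ 1]))"

definition fwedge21 :: "('a::real_vector, 2) kform \<Rightarrow> ('a, 1) kform \<Rightarrow> ('a, 3) kform" where
  "fwedge21 \<gamma> \<beta> = Abs_kform (\<lambda>x.
     form_at \<gamma> (vector [x $ 1, x $ 2]) * form_at \<beta> (vector [x $ 3])
   - form_at \<gamma> (vector [x $ 1, x $ 3]) * form_at \<beta> (vector [x $ 2])
   + form_at \<gamma> (vector [x $ 2, x $ 3]) * form_at \<beta> (vector [x $ 1]))"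

definition fwedge12 :: "('a::real_vector, 1) kform \<Rightarrow> ('a, 2) kform \<Rightarrow> ('a, 3) kform" where
  "fwedge12 \<alpha> \<gamma> = Abs_kform (\<lambda>x.
     form_at \<alpha> (vector [x $ 1]) * form_at \<gamma> (vector [x $ 2, x $ 3])
   - form_at \<alpha> (vector [x $ 2]) * form_at \<gamma> (vector [x $ 1, x $ 3])
   + form_at \<alpha> (vector [x $ 3]) * form_at \<gamma> (vector [x $ 1, x $ 2]))"

lemma form_at_fwedge11:
  "form_at (fwedge11 \<alpha> \<beta>) x =
     form_at \<alpha> (vector [x $ 1]) * form_at \<beta> (vector [x $ 2])
   - form_at \<alpha> (vector [x $ 2]) * form_at \<beta> (vector [x $ 1])"
  unfolding fwedge11_def
  by (subst Abs_kform_inverse)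
    (use form1_linear[of \<alpha>] form1_linear[of \<beta>] in
      \<open>auto simp: linear_iff algebra_simps intro!: alternating_form_2I\<close>)

lemma form_at_fwedge21:
  fixes \<gamma> :: "('a::real_vector, 2) kform"
  shows "form_at (fwedge21 \<gamma> \<beta>) x =
     form_at \<gamma> (vector [x $ 1, x $ 2]) * form_at \<beta> (vector [x $ 3])
   - form_at \<gamma> (vector [x $ 1, x $ 3]) * form_at \<beta> (vector [x $ 2])
   + form_at \<gamma> (vector [x $ 2, x $ 3]) * form_at \<beta> (vector [x $ 1])"
proof -
  let ?f = "\<lambda>a b c :: 'a.
     form_at \<gamma> (vector [a, b]) * form_at \<beta> (vector [c])
   - form_at \<gamma> (vector [a, c]) * form_at \<beta> (vector [b])
   + form_at \<gamma> (vector [b, c]) * form_at \<beta> (vector [a])"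
  have "alternating_form (\<lambda>x :: 'a^3. ?f (x $ 1) (x $ 2) (x $ 3))"
  proof (rule alternating_form_3I[of ?f])
    show "?f a b a = 0" for a b
      using form2_swap[of \<gamma> a b] by (simp add: form2_alt)
  qed (use form1_linear[of \<beta>] form2_linear[of \<gamma>] in
      \<open>auto simp: linear_iff algebra_simps form2_alt\<close>)
  then show ?thesis unfolding fwedge21_def by (simp add: Abs_kform_inverse)
qed

lemma form_at_fwedge12:
  fixes \<gamma> :: "('a::real_vector, 2) kform"
  shows "form_at (fwedge12 \<alpha> \<gamma>) x =
     form_at \<alpha> (vector [x $ 1]) * form_at \<gamma> (vector [x $ 2, x $ 3])
   - form_at \<alpha> (vector [x $ 2]) * form_at \<gamma> (vector [x $ 1, x $ 3])
   + form_at \<alpha> (vector [x $ 3]) * form_at \<gamma> (vector [x $ 1, x $ 2])"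
proof -
  let ?f = "\<lambda>a b c :: 'a.
     form_at \<alpha> (vector [a]) * form_at \<gamma> (vector [b, c])
   - form_at \<alpha> (vector [b]) * form_at \<gamma> (vector [a, c])
   + form_at \<alpha> (vector [c]) * form_at \<gamma> (vector [a, b])"
  have "alternating_form (\<lambda>x :: 'a^3. ?f (x $ 1) (x $ 2) (x $ 3))"
  proof (rule alternating_form_3I[of ?f])
    show "?f a b a = 0" for a b
      using form2_swap[of \<gamma> a b] by (simp add: form2_alt)
  qed (use form1_linear[of \<alpha>] form2_linear[of \<gamma>] in
      \<open>auto simp: linear_iff algebra_simps form2_alt\<close>)
  then show ?thesis unfolding fwedge12_def by (simp add: Abs_kform_inverse)
qed

subsection \<open>The wedge product of two 2-vectors\<close>

text \<open>\<open>(u \<and> w)(\<omega>) = u((a, b) \<mapsto> w((c, d) \<mapsto> \<omega>(a, b, c, d)))\<close>. By \<open>wedge22_decomposable\<close>,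
  \<open>bilinear_wedge22\<close> and \<open>span_decomposable\<close> this is the usual product
  \<open>\<Lambda>\<^sup>2(V) \<times> \<Lambda>\<^sup>2(V) \<rightarrow> \<Lambda>\<^sup>4(V)\<close>.\<close>

definition insert2 :: "('a::real_vector, 4) kform \<Rightarrow> 'a ^ 2 \<Rightarrow> ('a, 2) kform" where
  "insert2 \<omega> x = Abs_kform (\<lambda>y. form_at \<omega> (vector [x $ 1, x $ 2, y $ 1, y $ 2]))"

definition contract2 :: "('a::real_vector, 4) kform \<Rightarrow> ('a, 2) kvector \<Rightarrow> ('a, 2) kform" where
  "contract2 \<omega> w = Abs_kform (\<lambda>x. pairing (insert2 \<omega> x) w)"

definition wedge22 :: "('a::real_vector, 2) kvector \<Rightarrow> ('a, 2) kvector \<Rightarrow> ('a, 4) kvector" where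
  "wedge22 u w = Abs_kvector (\<lambda>\<omega>. pairing (contract2 \<omega> w) u)"

lemma form_at_insert2:
  "form_at (insert2 \<omega> x) y = form_at \<omega> (vector [x $ 1, x $ 2, y $ 1, y $ 2])"
  unfolding insert2_def
  by (subst Abs_kform_inverse)
    (auto intro!: alternating_form_2I form4_linear form4_alt)

lemma form_at_contract2:
  fixes w :: "('a::real_vector, 2) kvector"
  shows "form_at (contract2 \<omega> w) x = pairing (insert2 \<omega> x) w"
proof -
  note L = linear_pairing_left[of w]
  have add1: "insert2 \<omega> (vector [a + a', b]) = insert2 \<omega> (vector [a, b]) + insert2 \<omega> (vector [a', b])"
    and add2: "insert2 \<omega> (vector [b, a + a']) = insert2 \<omega> (vector [b, a]) + insert2 \<omega> (vector [b, a'])"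
    and sc1: "insert2 \<omega> (vector [r *\<^sub>R a, b]) = r *\<^sub>R insert2 \<omega> (vector [a, b])"
    and sc2: "insert2 \<omega> (vector [b, r *\<^sub>R a]) = r *\<^sub>R insert2 \<omega> (vector [b, a])"
    and alt: "insert2 \<omega> (vector [a, a]) = 0"
    for a a' b :: 'a and r
    using form4_linear[of \<omega>]
    by (auto intro!: kform_eqI simp: form_at_insert2 form_at_simps form4_alt linear_iff)
  have "alternating_form (\<lambda>x :: 'a^2. pairing (insert2 \<omega> (vector [x $ 1, x $ 2])) w)"
    by (rule alternating_form_2I[of "\<lambda>a b. pairing (insert2 \<omega> (vector [a, b])) w"])
      (auto simp: linear_iff add1 add2 sc1 sc2 alt linear_add[OF L] linear_cmul[OF L] linear_0[OF L])
  then show ?thesis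
    unfolding contract2_def vector_eta by (simp add: Abs_kform_inverse)
qed

lemma pairing_wedge22: "pairing \<omega> (wedge22 u w) = pairing (contract2 \<omega> w) u"
proof -
  note L = linear_pairing_left
  have i: "insert2 (\<omega> + \<omega>') x = insert2 \<omega> x + insert2 \<omega>' x"
    "insert2 (r *\<^sub>R \<omega>) x = r *\<^sub>R insert2 \<omega> x" for \<omega> \<omega>' :: "('a, 4) kform" and r x
    by (auto intro!: kform_eqI simp: form_at_insert2 form_at_simps)
  have "contract2 (\<omega> + \<omega>') w = contract2 \<omega> w + contract2 \<omega>' w"
    "contract2 (r *\<^sub>R \<omega>) w = r *\<^sub>R contract2 \<omega> w" for \<omega> \<omega>' :: "('a, 4) kform" and r
    by (auto intro!: kform_eqI
        simp: form_at_contract2 form_at_simps i linear_add[OF L] linear_cmul[OF L])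
  then have "linear (\<lambda>\<omega>. pairing (contract2 \<omega> w) u)"
    by (simp add: linear_iff linear_add[OF L] linear_cmul[OF L])
  then show ?thesis
    by (simp add: wedge22_def pairing_def Abs_kvector_inverse)
qed

lemma wedge22_decomposable:
  "wedge22 (decomposable (vector [a, b])) (decomposable (vector [c, d]))
   = decomposable (vector [a, b, c, d])"
  by (rule kvector_eqI)
    (simp add: pairing_wedge22 pairing_decomposable form_at_contract2 form_at_insert2)

lemma bilinear_wedge22: "bilinear wedge22"
proof -
  note L = linear_pairing_left and R = linear_pairing_right
  have "contract2 \<omega> (w + w') = contract2 \<omega> w + contract2 \<omega> w'"
    "contract2 \<omega> (r *\<^sub>R w) = r *\<^sub>R contract2 \<omega> w" for \<omega> :: "('a, 4) kform" and w w' r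
    by (auto intro!: kform_eqI
        simp: form_at_contract2 form_at_simps linear_add[OF R] linear_cmul[OF R])
  then show ?thesis
    by (auto simp: bilinear_def linear_iff pairing_wedge22 linear_add[OF R] linear_cmul[OF R]
        linear_add[OF L] linear_cmul[OF L] intro!: kvector_eqI)
qed

subsection \<open>Finite dimension\<close>

lemma kform_eq_0_if_basis:
  fixes \<alpha> :: "('a::real_vector, 'k::finite) kform"
  assumes B: "span B = (UNIV :: 'a set)" and z: "\<And>x. (\<And>i. x $ i \<in> B) \<Longrightarrow> form_at \<alpha> x = 0"
  shows "\<alpha> = 0"
proof -
  have "\<forall>x. (\<forall>i. i \<notin> S \<longrightarrow> x $ i \<in> B) \<longrightarrow> form_at \<alpha> x = 0" if "finite S" for S
    using that
  proof (induction S)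
    case empty
    then show ?case using z by auto
  next
    case (insert i S)
    show ?case
    proof (intro allI impI)
      fix x assume x: "\<forall>j. j \<notin> insert i S \<longrightarrow> x $ j \<in> B"
      let ?f = "\<lambda>v. form_at \<alpha> (\<chi> j. if j = i then v else x $ j)"
      have lin: "linear ?f"
        using form_at[of \<alpha>] by (simp only: alternating_form_def mem_Collect_eq)
      have "?f v = 0" if "v \<in> B" for v
        using insert.IH x that by simp
      then have "?f (x $ i) = 0"
        using linear_eq_0_on_span[OF lin, of B "x $ i"] B by blast
      moreover have "(\<chi> j. if j = i then x $ i else x $ j) = x"
        by (simp add: vec_eq_iff)
      ultimately show "form_at \<alpha> x = 0" by simp
    qed
  qed
  from this[of UNIV] show ?thesis
    by (intro kform_eqI) (simp add: form_at_simps)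
qed

lemma in_span_if_kernel_le:
  fixes f :: "'t \<Rightarrow> ('a::real_vector, 'k::finite) kvector"
  assumes "finite T" "\<And>\<alpha>. (\<forall>t\<in>T. pairing \<alpha> (f t) = 0) \<Longrightarrow> pairing \<alpha> u = 0"
  shows "u \<in> span (f ` T)"
  using assms
proof (induction T arbitrary: u)
  case empty
  then have "u = 0" by (intro kvector_eqI) (simp add: linear_0[OF linear_pairing_right])
  then show ?case by simp
next
  case (insert t T)
  note L = linear_pairing_left and R = linear_pairing_right
  have sub: "span (f ` T) \<subseteq> span (f ` insert t T)" by (intro span_mono) auto
  show ?case
  proof (cases "\<exists>z. (\<forall>s\<in>T. pairing z (f s) = 0) \<and> pairing z (f t) \<noteq> 0")
    case True
    then obtain z where z: "\<forall>s\<in>T. pairing z (f s) = 0" "pairing z (f t) \<noteq> 0" by blast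
    define c where "c = pairing z u / pairing z (f t)"
    have "u - c *\<^sub>R f t \<in> span (f ` T)"
    proof (rule insert.IH)
      fix \<alpha> assume \<alpha>: "\<forall>s\<in>T. pairing \<alpha> (f s) = 0"
      let ?d = "pairing \<alpha> (f t) / pairing z (f t)"
      have "pairing (\<alpha> - ?d *\<^sub>R z) u = 0"
        using z \<alpha> by (intro insert.prems) (auto simp: linear_diff[OF L] linear_cmul[OF L])
      then show "pairing \<alpha> (u - c *\<^sub>R f t) = 0"
        by (simp add: linear_diff[OF L] linear_cmul[OF L] linear_diff[OF R] linear_cmul[OF R] c_def)
    qed
    then have "(u - c *\<^sub>R f t) + c *\<^sub>R f t \<in> span (f ` insert t T)"
      using sub by (intro span_add span_scale) (auto intro: span_base)
    then show ?thesis by simp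
  next
    case False
    then have "u \<in> span (f ` T)"
      by (intro insert.IH insert.prems) auto
    then show ?thesis using sub by blast
  qed
qed

lemma span_decomposable:
  assumes "finite B" "span B = (UNIV :: 'a::real_vector set)"
  shows "span (range decomposable) = (UNIV :: ('a, 'k::finite) kvector set)"
proof -
  let ?T = "{x :: 'a ^ 'k. \<forall>i. x $ i \<in> B}"
  have "?T \<subseteq> vec_lambda ` {g. \<forall>i. g i \<in> B}"
    by (auto intro!: image_eqI[of _ _ "vec_nth _"])
  moreover have "{g. \<forall>i. g i \<in> B} = (UNIV :: 'k set) \<rightarrow>\<^sub>E B"
    by auto
  ultimately have fin: "finite ?T"
    using assms(1) by (metis finite finite_PiE finite_imageI finite_subset)
  have "u \<in> span (decomposable ` ?T)" for u
  proof (rule in_span_if_kernel_le[OF fin])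
    fix \<alpha> :: "('a, 'k) kform"
    assume "\<forall>x\<in>?T. pairing \<alpha> (decomposable x) = 0"
    then have "\<alpha> = 0"
      by (intro kform_eq_0_if_basis[OF assms(2)]) (simp add: pairing_decomposable)
    then show "pairing \<alpha> u = 0" by (simp add: linear_0[OF linear_pairing_left])
  qed
  moreover have "span (decomposable ` ?T) \<subseteq> span (range decomposable)"
    by (intro span_mono) auto
  ultimately show ?thesis by blast
qed

lemma dim_4_basis:
  assumes "dim (UNIV :: 'a::real_vector set) = 4"
  obtains B :: "'a::real_vector set" where "finite B" "card B = 4" "independent B" "span B = UNIV"
proof -
  obtain B :: "'a set" where B: "independent B" "UNIV \<subseteq> span B" "card B = dim (UNIV :: 'a set)"
    using basis_exists[of UNIV] by metis
  with assms have "finite B" by (metis card.infinite zero_neq_numeral)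
  with B assms show ?thesis by (intro that[of B]) auto
qed

section \<open>Lie algebras and the Chevalley--Eilenberg differential\<close>

definition lie_bracket :: "('a::real_vector \<Rightarrow> 'a \<Rightarrow> 'a) \<Rightarrow> bool" where
  "lie_bracket br \<longleftrightarrow>
     bilinear br \<and> (\<forall>x. br x x = 0) \<and>
     (\<forall>x y z. br x (br y z) + br y (br z x) + br z (br x y) = 0)"

text \<open>\<open>d1\<close>, \<open>d2\<close> are the components of \<open>d\<close> in degrees 1 and 2.\<close>

definition ce_differential ::
  "('a::real_vector \<Rightarrow> 'a \<Rightarrow> 'a) \<Rightarrow> (('a, 1) kform \<Rightarrow> ('a, 2) kform)
    \<Rightarrow> (('a, 2) kform \<Rightarrow> ('a, 3) kform) \<Rightarrow> bool" where
  "ce_differential br d1 d2 \<longleftrightarrow>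
     linear d1 \<and> linear d2 \<and>
     (\<forall>\<phi> u v. form_at (d1 \<phi>) (vector [u, v]) = - form_at \<phi> (vector [br u v])) \<and>
     (\<forall>\<alpha> \<beta>. d2 (fwedge11 \<alpha> \<beta>) = fwedge21 (d1 \<alpha>) \<beta> - fwedge12 \<alpha> (d1 \<beta>))"

text \<open>The differential on 2-forms; see \<open>ce_d_eq\<close> for existence and uniqueness in the case of interest
  and for the explicit formula.\<close>

definition ce_d :: "('a::real_vector \<Rightarrow> 'a \<Rightarrow> 'a) \<Rightarrow> ('a, 2) kform \<Rightarrow> ('a, 3) kform" where
  "ce_d br = (THE d2. \<exists>d1. ce_differential br d1 d2)"

lemma ce_differential_unique:
  fixes br :: "'a::real_vector \<Rightarrow> 'a \<Rightarrow> 'a"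
  assumes dim: "dim (UNIV :: 'a set) = 4"
    and d: "ce_differential br d1 d2" and e: "ce_differential br e1 e2"
  shows "d1 = e1" "d2 = e2"
proof -
  show 1: "d1 = e1"
  proof (intro ext kform_eqI)
    fix \<phi> and x :: "'a^2"
    have "form_at (d1 \<phi>) (vector [x $ 1, x $ 2]) = form_at (e1 \<phi>) (vector [x $ 1, x $ 2])"
      using d e by (simp add: ce_differential_def)
    then show "form_at (d1 \<phi>) x = form_at (e1 \<phi>) x"
      by (simp only: vector_eta)
  qed
  obtain B :: "'a set" where B: "finite B" "card B = 4" "independent B" "span B = UNIV"
    by (rule dim_4_basis[OF dim])
  have "\<exists>\<rho> :: ('a, 1) kform. \<forall>c\<in>B. form_at \<rho> (vector [c]) = (if c = b then 1 else 0)" for b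
  proof -
    obtain f where f: "linear f" "\<forall>c\<in>B. f c = (if c = b then 1 else 0 :: real)"
      using linear_independent_extend[OF B(3), of "\<lambda>c. if c = b then 1 else 0"] by blast
    let ?\<rho> = "Abs_kform (\<lambda>x :: 'a^1. f (x $ 1))"
    have "alternating_form (\<lambda>x :: 'a^1. f (x $ 1))"
      using f(1) by (auto simp: alternating_form_def forall_1)
    then have "\<forall>c\<in>B. form_at ?\<rho> (vector [c]) = (if c = b then 1 else 0)"
      using f(2) by (simp add: Abs_kform_inverse)
    then show ?thesis by (rule exI[of _ ?\<rho>])
  qed
  then have "\<exists>\<rho> :: 'a \<Rightarrow> ('a, 1) kform. \<forall>b. \<forall>c\<in>B.
      form_at (\<rho> b) (vector [c]) = (if c = b then 1 else 0)"
    by (intro choice allI)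
  then obtain \<rho> :: "'a \<Rightarrow> ('a, 1) kform" where
    \<rho>: "\<And>b c. c \<in> B \<Longrightarrow> form_at (\<rho> b) (vector [c]) = (if c = b then 1 else 0)"
    by auto
  have if_nest: "(\<Sum>b\<in>B. if P then g b else 0) = (if P then sum g B else 0)"
    for P and g :: "'a \<Rightarrow> real"
    by simp
  show "d2 = e2"
  proof
    fix \<phi> :: "('a, 2) kform"
    let ?s = "\<Sum>a\<in>B. \<Sum>b\<in>B. (form_at \<phi> (vector [a, b]) / 2) *\<^sub>R fwedge11 (\<rho> a) (\<rho> b)"
    have "\<phi> - ?s = 0"
    proof (rule kform_eq_0_if_basis[OF B(4)])
      fix x :: "'a^2" assume x: "\<And>i. x $ i \<in> B"
      define p q where "p = x $ 1" and "q = x $ 2"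
      have pq: "p \<in> B" "q \<in> B" "x = vector [p, q]"
        using x by (auto simp: p_def q_def vector_eta)
      have "form_at ?s x = (\<Sum>a\<in>B. \<Sum>b\<in>B. (if a = p then if b = q then form_at \<phi> (vector [a, b]) / 2 else 0 else 0)
           - (if a = q then if b = p then form_at \<phi> (vector [a, b]) / 2 else 0 else 0))"
        unfolding form_at_sum
        by (intro sum.cong refl) (auto simp: form_at_simps form_at_fwedge11 pq \<rho>)
      also have "\<dots> = form_at \<phi> (vector [p, q]) / 2 - form_at \<phi> (vector [q, p]) / 2"
        using B(1) pq by (simp only: sum_subtractf if_nest sum.delta if_True)
      also have "\<dots> = form_at \<phi> x" by (simp add: form2_swap[of \<phi> q p] pq)
      finally show "form_at (\<phi> - ?s) x = 0" by (simp add: form_at_simps)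
    qed
    then have \<phi>: "\<phi> = ?s" by simp
    have "d2 (fwedge11 \<alpha> \<beta>) = e2 (fwedge11 \<alpha> \<beta>)" for \<alpha> \<beta>
      using d e 1 by (simp add: ce_differential_def)
    moreover have "linear d2" "linear e2" using d e by (auto simp: ce_differential_def)
    ultimately have s: "d2 ?s = e2 ?s" by (simp add: linear_sum linear_cmul)
    have "d2 \<phi> = d2 ?s" by (rule arg_cong[OF \<phi>])
    also note s
    also have "e2 ?s = e2 \<phi>" by (rule arg_cong[OF \<phi>[symmetric]])
    finally show "d2 \<phi> = e2 \<phi>" .
  qed
qed

lemma ce_d_eq:
  fixes br :: "'a::real_vector \<Rightarrow> 'a \<Rightarrow> 'a"
  assumes dim: "dim (UNIV :: 'a set) = 4" and br: "lie_bracket br"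
  shows "\<exists>d1. ce_differential br d1 (ce_d br)"
    and "form_at (ce_d br \<phi>) (vector [a, b, c]) =
       - form_at \<phi> (vector [br a b, c]) - form_at \<phi> (vector [br b c, a])
       - form_at \<phi> (vector [br c a, b])"
proof -
  have bl: "br (x + y) z = br x z + br y z" "br z (x + y) = br z x + br z y"
    "br (r *\<^sub>R x) z = r *\<^sub>R br x z" "br z (r *\<^sub>R x) = r *\<^sub>R br z x" "br x x = 0" for x y z r
    using br by (auto simp: lie_bracket_def bilinear_def linear_iff)
  have sw: "br y x = - br x y" for x y
  proof -
    have "br (x + y) (x + y) = (br x x + br y x) + (br x y + br y y)"
      by (simp only: bl(1,2))
    then have "br x y + br y x = 0"
      unfolding bl(5) by (simp add: add.commute)
    then show ?thesis by (metis minus_unique)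
  qed
  have br0: "form_at \<alpha> (vector [- x]) = - form_at \<alpha> (vector [x])" for \<alpha> :: "('a, 1) kform" and x
    using linear_neg[OF form1_linear] .
  have neg2: "form_at \<alpha> (vector [- x, y]) = - form_at \<alpha> (vector [x, y])"
    for \<alpha> :: "('a, 2) kform" and x y
    using linear_neg[OF form2_linear(1)] .
  have z1: "form_at \<alpha> (vector [0]) = 0" for \<alpha> :: "('a, 1) kform"
    using linear_0[OF form1_linear] .
  have z2: "form_at \<alpha> (vector [0, y]) = 0" for \<alpha> :: "('a, 2) kform" and y
    using linear_0[OF form2_linear(1)] .
  define d1 where "d1 \<phi> = Abs_kform (\<lambda>x :: 'a^2. - form_at \<phi> (vector [br (x $ 1) (x $ 2)]))"
    for \<phi> :: "('a, 1) kform"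
  define d2 where "d2 \<phi> = Abs_kform (\<lambda>x :: 'a^3.
       - form_at \<phi> (vector [br (x $ 1) (x $ 2), x $ 3]) - form_at \<phi> (vector [br (x $ 2) (x $ 3), x $ 1])
       - form_at \<phi> (vector [br (x $ 3) (x $ 1), x $ 2]))" for \<phi> :: "('a, 2) kform"
  have d1: "form_at (d1 \<phi>) x = - form_at \<phi> (vector [br (x $ 1) (x $ 2)])" for \<phi> x
    unfolding d1_def
    by (subst Abs_kform_inverse)
      (use form1_linear[of \<phi>] in \<open>auto simp: linear_iff bl z1 intro!: alternating_form_2I\<close>)
  have d2: "form_at (d2 \<phi>) x =
       - form_at \<phi> (vector [br (x $ 1) (x $ 2), x $ 3]) - form_at \<phi> (vector [br (x $ 2) (x $ 3), x $ 1])
       - form_at \<phi> (vector [br (x $ 3) (x $ 1), x $ 2])" for \<phi> x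
    unfolding d2_def
  proof (subst Abs_kform_inverse)
    let ?f = "\<lambda>a b c. - form_at \<phi> (vector [br a b, c]) - form_at \<phi> (vector [br b c, a])
       - form_at \<phi> (vector [br c a, b])"
    have *: "form_at \<phi> (vector [br y x, z]) = - form_at \<phi> (vector [br x y, z])" for x y z
      by (subst sw) (rule neg2)
    have "alternating_form (\<lambda>x :: 'a^3. ?f (x $ 1) (x $ 2) (x $ 3))"
    proof (rule alternating_form_3I[of ?f])
      show "?f a a b = 0" "?f a b a = 0" "?f b a a = 0" for a b
        using *[of a b a] by (simp_all add: bl z2)
    qed (use form2_linear[of \<phi>] in \<open>auto simp: linear_iff bl algebra_simps\<close>)
    then show "(\<lambda>x :: 'a^3.
       - form_at \<phi> (vector [br (x $ 1) (x $ 2), x $ 3]) - form_at \<phi> (vector [br (x $ 2) (x $ 3), x $ 1])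
       - form_at \<phi> (vector [br (x $ 3) (x $ 1), x $ 2])) \<in> {f. alternating_form f}"
      by simp
  qed simp
  have ex: "ce_differential br d1 d2"
    unfolding ce_differential_def
  proof (intro conjI allI)
    show "linear d1" "linear d2"
      by (auto simp: linear_iff d1 d2 form_at_simps algebra_simps intro!: kform_eqI)
    show "form_at (d1 \<phi>) (vector [u, v]) = - form_at \<phi> (vector [br u v])" for \<phi> u v
      by (simp add: d1)
    show "d2 (fwedge11 \<alpha> \<beta>) = fwedge21 (d1 \<alpha>) \<beta> - fwedge12 \<alpha> (d1 \<beta>)" for \<alpha> \<beta>
    proof (rule kform_eqI)
      fix x :: "'a^3"
      have "br (x $ 3) (x $ 1) = - br (x $ 1) (x $ 3)" by (rule sw)
      then show "form_at (d2 (fwedge11 \<alpha> \<beta>)) x = form_at (fwedge21 (d1 \<alpha>) \<beta> - fwedge12 \<alpha> (d1 \<beta>)) x"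
        by (simp add: d1 d2 form_at_simps form_at_fwedge11 form_at_fwedge21 form_at_fwedge12 br0
            algebra_simps)
    qed
  qed
  have eq: "ce_d br = d2"
    unfolding ce_d_def
  proof (rule the_equality)
    show "\<exists>d1. ce_differential br d1 d2" using ex by blast
  next
    fix e2 assume "\<exists>e1. ce_differential br e1 e2"
    then show "e2 = d2" using ce_differential_unique(2)[OF dim _ ex] by blast
  qed
  show "\<exists>d1. ce_differential br d1 (ce_d br)" using ex eq by auto
  show "form_at (ce_d br \<phi>) (vector [a, b, c]) =
       - form_at \<phi> (vector [br a b, c]) - form_at \<phi> (vector [br b c, a])
       - form_at \<phi> (vector [br c a, b])"
    by (simp add: eq d2)
qed

definition boundaries :: "('a::real_vector \<Rightarrow> 'a \<Rightarrow> 'a) \<Rightarrow> ('a, 2) kvector set" where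
  "boundaries br =
     {u. \<exists>w :: ('a, 3) kvector. \<forall>\<phi> :: ('a, 2) kform. pairing \<phi> u = pairing (ce_d br \<phi>) w}"

section \<open>Almost complex structures\<close>

definition almost_complex :: "('a::real_vector \<Rightarrow> 'a) \<Rightarrow> bool" where
  "almost_complex J \<longleftrightarrow> linear J \<and> bij J \<and> (\<forall>v. J (J v) = - v)"

definition Lambda_plus :: "('a::real_vector \<Rightarrow> 'a) \<Rightarrow> ('a, 2) kform set" where
  "Lambda_plus J =
     {\<alpha>. \<forall>u v. form_at \<alpha> (vector [J u, J v]) = form_at \<alpha> (vector [u, v])}"

definition tamed_form ::
  "('a::real_vector \<Rightarrow> 'a \<Rightarrow> 'a) \<Rightarrow> ('a \<Rightarrow> 'a) \<Rightarrow> ('a, 2) kform \<Rightarrow> bool" where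
  "tamed_form br J \<phi> \<longleftrightarrow>
     ce_d br \<phi> = 0 \<and> (\<forall>v. v \<noteq> 0 \<longrightarrow> pairing \<phi> (decomposable (vector [v, J v])) > 0)"

definition compatible_form ::
  "('a::real_vector \<Rightarrow> 'a \<Rightarrow> 'a) \<Rightarrow> ('a \<Rightarrow> 'a) \<Rightarrow> ('a, 2) kform \<Rightarrow> bool" where
  "compatible_form br J \<phi> \<longleftrightarrow> tamed_form br J \<phi> \<and> \<phi> \<in> Lambda_plus J"

definition tamed :: "('a::real_vector \<Rightarrow> 'a \<Rightarrow> 'a) \<Rightarrow> ('a \<Rightarrow> 'a) \<Rightarrow> bool" where
  "tamed br J \<longleftrightarrow> (\<exists>\<phi>. tamed_form br J \<phi>)"

definition almost_kaehler :: "('a::real_vector \<Rightarrow> 'a \<Rightarrow> 'a) \<Rightarrow> ('a \<Rightarrow> 'a) \<Rightarrow> bool" where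
  "almost_kaehler br J \<longleftrightarrow> (\<exists>\<phi>. compatible_form br J \<phi>)"

end

theory Submission
  imports Defs
begin

text \<open>
  Let \<open>q\<close> be the wedge product on 2-forms of a 4-dimensional space, read as a symmetric bilinear form
  by evaluation on a complex frame. It makes \<open>\<Lambda>\<^sub>J\<^sup>+\<close> and \<open>\<Lambda>\<^sub>J\<^sup>-\<close> orthogonal, is positive definite on
  \<open>\<Lambda>\<^sub>J\<^sup>-\<close>, and has signature \<open>(1,3)\<close> on \<open>\<Lambda>\<^sub>J\<^sup>+\<close>, where \<open>q \<alpha> \<alpha>\<close> is twice the determinant of the
  Hermitian matrix of \<open>\<alpha>\<close>; so an invariant form with \<open>q \<alpha> \<alpha> > 0\<close> is positive on all pairs \<open>v, J v\<close>
  up to its sign (\<open>positive_if_q_pos\<close>).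

  Let \<open>\<phi>\<close> tame \<open>J\<close>. Its invariant part \<open>\<phi>\<^sup>+\<close> takes the same values on the pairs \<open>v, J v\<close>, hence
  \<open>q \<phi>\<^sup>+ \<phi>\<^sup>+ > 0\<close>, but it need not be closed. The volume form \<open>\<phi> \<and> \<phi>\<close> sends a 2-vector \<open>u\<close> to a
  2-form \<open>*u\<close>, with \<open>q (*u) \<psi>\<close> proportional to \<open>\<psi>(u)\<close> (\<open>fwedge22_contract2\<close>). Since a form is closed
  exactly if it vanishes on the boundaries (\<open>closed_iff_annihilates_boundaries\<close>), an invariant form
  is closed exactly if it is \<open>q\<close>-orthogonal to the space \<open>C\<close> of the invariant parts of the \<open>*u\<close>,
  \<open>u \<in> B\<close>. The candidate is therefore the component \<open>\<tau>\<close> of \<open>\<phi>\<^sup>+\<close> orthogonal to \<open>C\<close>.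

  This works because \<open>q\<close> is negative definite on \<open>C\<close>. Indeed \<open>B \<and> B = 0\<close> says that \<open>*u\<close> is null,
  so that its invariant part \<open>c\<close> and its anti-invariant part \<open>n\<close> satisfy \<open>q c c = - q n n \<le> 0\<close>. If
  equality holds, then \<open>n = 0\<close> and \<open>c = *u\<close> is orthogonal to the closed form \<open>\<phi>\<close>, hence to \<open>\<phi>\<^sup>+\<close>; but
  in signature \<open>(1,3)\<close> only \<open>0\<close> is both null and orthogonal to a vector of positive square
  (\<open>plus_eq_0_if_orthogonal\<close>). Consequently the projection along \<open>C\<close> exists
  (\<open>anisotropic_projection\<close>), and writing \<open>\<phi>\<^sup>+ = c + \<tau>\<close> gives \<open>q \<tau> \<tau> = q \<phi>\<^sup>+ \<phi>\<^sup>+ - q c c > 0\<close>. So \<open>\<tau>\<close> or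
  \<open>- \<tau>\<close> is compatible with \<open>J\<close>.
\<close>

section \<open>Orthogonal projection along an anisotropic subspace\<close>

text \<open>Gram--Schmidt, one generator at a time; anisotropy keeps the divisors \<open>\<beta> s' s'\<close> away from zero.\<close>

lemma anisotropic_projection:
  fixes \<beta> :: "'v::real_vector \<Rightarrow> 'v \<Rightarrow> real"
  assumes bil: "bilinear \<beta>" and "finite S"
    and "\<And>x. x \<in> span S \<Longrightarrow> \<beta> x x = 0 \<Longrightarrow> x = 0"
  shows "\<exists>c\<in>span S. \<forall>s\<in>span S. \<beta> (v - c) s = 0"
  using assms(2,3)
proof (induction S arbitrary: v)
  case empty
  show ?case using bilinear_rzero[OF bil] by simp
next
  case (insert s S)
  have sub: "span S \<subseteq> span (insert s S)" by (intro span_mono) auto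
  then have IH: "\<exists>c\<in>span S. \<forall>s\<in>span S. \<beta> (v - c) s = 0" for v
    using insert.prems by (intro insert.IH) (simp add: subset_iff)
  obtain c where c: "c \<in> span S" "\<And>x. x \<in> span S \<Longrightarrow> \<beta> (v - c) x = 0"
    using IH[of v] by blast
  obtain d where d: "d \<in> span S" "\<And>x. x \<in> span S \<Longrightarrow> \<beta> (s - d) x = 0"
    using IH[of s] by blast
  define s' where "s' = s - d"
  have s': "s' \<in> span (insert s S)"
    unfolding s'_def using d(1) sub by (intro span_diff) (auto intro: span_base)
  \<comment> \<open>If \<open>s \<in> span S\<close>, then \<open>s' = 0\<close>, the division gives \<open>k = 0\<close>, and the step changes nothing.\<close>
  define k where "k = \<beta> (v - c) s' / \<beta> s' s'"
  show ?case
  proof (intro bexI ballI)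
    show "c + k *\<^sub>R s' \<in> span (insert s S)"
      using c(1) sub s' by (intro span_add span_scale) auto
    fix x assume "x \<in> span (insert s S)"
    then obtain r where r: "x - r *\<^sub>R s \<in> span S" by (auto simp: span_insert)
    define y where "y = x - r *\<^sub>R s + r *\<^sub>R d"
    have y: "y \<in> span S" unfolding y_def using r d(1) by (intro span_add span_scale)
    have x: "x = y + r *\<^sub>R s'" by (simp add: y_def s'_def algebra_simps)
    have 1: "\<beta> (v - c) y = 0" "\<beta> s' y = 0" using c(2) d(2) y by (auto simp: s'_def)
    have "\<beta> (v - c) s' = k * \<beta> s' s'"
    proof (cases "\<beta> s' s' = 0")
      case True
      then have "s' = 0" using insert.prems s' by blast
      then show ?thesis using bilinear_rzero[OF bil] by simp
    qed (simp add: k_def)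
    moreover have "v - (c + k *\<^sub>R s') = (v - c) - k *\<^sub>R s'" by simp
    ultimately show "\<beta> (v - (c + k *\<^sub>R s')) x = 0"
      using 1 by (simp only: x bilinear_radd[OF bil] bilinear_lsub[OF bil, of "v - c"]
          bilinear_lmul[OF bil] bilinear_rmul[OF bil]) simp
  qed
qed

text \<open>Spaces of forms are finite-dimensional, but not by their type; an injection into a Euclidean
  space transports the finiteness of independent sets.\<close>

lemma finite_basis_if_injective:
  fixes h :: "'v::real_vector \<Rightarrow> 'b::euclidean_space" and C :: "'v set"
  assumes "linear h" "inj h" "subspace C"
  obtains S where "finite S" "span S = C"
proof -
  obtain S where S: "S \<subseteq> C" "independent S" "C \<subseteq> span S"
    by (rule basis_exists[of C])
  have inj: "inj_on h T" for T using assms(2) by (rule inj_on_subset) simp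
  have "independent (h ` S)"
    by (rule linear_independent_injective_image[OF assms(1) S(2) inj])
  then have "finite (h ` S)" by (rule independent_imp_finite)
  then have "finite S" using inj by (rule finite_imageD)
  moreover have "span S = C" by (rule subset_antisym[OF span_minimal[OF S(1) assms(3)] S(3)])
  ultimately show ?thesis by (rule that)
qed

section \<open>Wedge products of 2-forms\<close>

lemmas form2_simps =
  linear_add[OF form2_linear(1)] linear_add[OF form2_linear(2)]
  linear_cmul[OF form2_linear(1)] linear_cmul[OF form2_linear(2)]
  linear_neg[OF form2_linear(1)] linear_neg[OF form2_linear(2)]
  linear_0[OF form2_linear(1)] linear_0[OF form2_linear(2)] form2_alt

lemma alternating_form_4I:
  fixes f :: "'a::real_vector \<Rightarrow> 'a \<Rightarrow> 'a \<Rightarrow> 'a \<Rightarrow> real"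
  assumes "\<And>b c d. linear (\<lambda>a. f a b c d)" "\<And>a c d. linear (\<lambda>b. f a b c d)"
    "\<And>a b d. linear (\<lambda>c. f a b c d)" "\<And>a b c. linear (\<lambda>d. f a b c d)"
    "\<And>a b c. f a a b c = 0" "\<And>a b c. f a b a c = 0" "\<And>a b c. f a b c a = 0"
    "\<And>a b c. f b a a c = 0" "\<And>a b c. f b a c a = 0" "\<And>a b c. f b c a a = 0"
  shows "alternating_form (\<lambda>x :: 'a^4. f (x $ 1) (x $ 2) (x $ 3) (x $ 4))"
  unfolding alternating_form_def using assms by (auto simp: forall_4)

definition fwedge22 :: "('a::real_vector, 2) kform \<Rightarrow> ('a, 2) kform \<Rightarrow> ('a, 4) kform" where
  "fwedge22 \<alpha> \<beta> = Abs_kform (\<lambda>x.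
     form_at \<alpha> (vector [x $ 1, x $ 2]) * form_at \<beta> (vector [x $ 3, x $ 4])
   - form_at \<alpha> (vector [x $ 1, x $ 3]) * form_at \<beta> (vector [x $ 2, x $ 4])
   + form_at \<alpha> (vector [x $ 1, x $ 4]) * form_at \<beta> (vector [x $ 2, x $ 3])
   + form_at \<alpha> (vector [x $ 2, x $ 3]) * form_at \<beta> (vector [x $ 1, x $ 4])
   - form_at \<alpha> (vector [x $ 2, x $ 4]) * form_at \<beta> (vector [x $ 1, x $ 3])
   + form_at \<alpha> (vector [x $ 3, x $ 4]) * form_at \<beta> (vector [x $ 1, x $ 2]))"

lemma form_at_fwedge22:
  fixes \<alpha> \<beta> :: "('a::real_vector, 2) kform"
  shows "form_at (fwedge22 \<alpha> \<beta>) (vector [a, b, c, d]) =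
     form_at \<alpha> (vector [a, b]) * form_at \<beta> (vector [c, d])
   - form_at \<alpha> (vector [a, c]) * form_at \<beta> (vector [b, d])
   + form_at \<alpha> (vector [a, d]) * form_at \<beta> (vector [b, c])
   + form_at \<alpha> (vector [b, c]) * form_at \<beta> (vector [a, d])
   - form_at \<alpha> (vector [b, d]) * form_at \<beta> (vector [a, c])
   + form_at \<alpha> (vector [c, d]) * form_at \<beta> (vector [a, b])"
proof -
  let ?f = "\<lambda>a b c d.
     form_at \<alpha> (vector [a, b]) * form_at \<beta> (vector [c, d])
   - form_at \<alpha> (vector [a, c]) * form_at \<beta> (vector [b, d])
   + form_at \<alpha> (vector [a, d]) * form_at \<beta> (vector [b, c])
   + form_at \<alpha> (vector [b, c]) * form_at \<beta> (vector [a, d])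
   - form_at \<alpha> (vector [b, d]) * form_at \<beta> (vector [a, c])
   + form_at \<alpha> (vector [c, d]) * form_at \<beta> (vector [a, b])"
  have "alternating_form (\<lambda>x :: 'a^4. ?f (x $ 1) (x $ 2) (x $ 3) (x $ 4))"
  proof (rule alternating_form_4I[of ?f])
    fix a b c :: 'a
    note swap = form2_swap[of \<alpha> a b] form2_swap[of \<beta> a b] form2_swap[of \<alpha> a c]
      form2_swap[of \<beta> a c]
    show "?f a a b c = 0" "?f a b a c = 0" "?f a b c a = 0" "?f b a a c = 0" "?f b a c a = 0"
      "?f b c a a = 0"
      using swap by (simp_all add: form2_alt)
  qed (auto simp: linear_iff form2_simps algebra_simps)
  then show ?thesis unfolding fwedge22_def by (simp add: Abs_kform_inverse)
qed

lemma fwedge22_commute: "fwedge22 \<alpha> \<beta> = fwedge22 \<beta> \<alpha>"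
  unfolding fwedge22_def by (simp add: algebra_simps)

lemma bilinear_fwedge22_at: "bilinear (\<lambda>\<alpha> \<beta>. form_at (fwedge22 \<alpha> \<beta>) (vector [a, b, c, d]))"
  by (auto simp: bilinear_def linear_iff form_at_fwedge22 form_at_simps algebra_simps)

lemma form4_swap:
  fixes \<omega> :: "('a::real_vector, 4) kform"
  shows "form_at \<omega> (vector [b, a, c, d]) = - form_at \<omega> (vector [a, b, c, d])"
    "form_at \<omega> (vector [a, c, b, d]) = - form_at \<omega> (vector [a, b, c, d])"
    "form_at \<omega> (vector [a, b, d, c]) = - form_at \<omega> (vector [a, b, c, d])"
proof -
  note add = linear_add[OF form4_linear(1)] linear_add[OF form4_linear(2)]
    linear_add[OF form4_linear(3)] linear_add[OF form4_linear(4)]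
  show "form_at \<omega> (vector [b, a, c, d]) = - form_at \<omega> (vector [a, b, c, d])"
    using form4_alt(1)[of \<omega> "a + b" c d] form4_alt(1)[of \<omega> a c d]
      form4_alt(1)[of \<omega> b c d] unfolding add by linarith
  show "form_at \<omega> (vector [a, c, b, d]) = - form_at \<omega> (vector [a, b, c, d])"
    using form4_alt(4)[of \<omega> a "b + c" d] form4_alt(4)[of \<omega> a b d]
      form4_alt(4)[of \<omega> a c d] unfolding add by linarith
  show "form_at \<omega> (vector [a, b, d, c]) = - form_at \<omega> (vector [a, b, c, d])"
    using form4_alt(6)[of \<omega> a b "c + d"] form4_alt(6)[of \<omega> a b c]
      form4_alt(6)[of \<omega> a b d] unfolding add by linarith
qed

text \<open>The identity \<open>(\<iota>\<^sub>w \<omega>) \<and> \<psi> = \<psi>(w) \<omega>\<close>: through the volume form, the wedge product of 2-forms becomes the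
  evaluation pairing. Both sides are pairings of \<open>w\<close> with a fixed 2-form, and two 2-forms agree if
  they agree on the frame.\<close>

lemma fwedge22_contract2:
  fixes e1 :: "'a::real_vector"
  assumes span: "span {e1, e2, e3, e4} = (UNIV :: 'a set)"
  shows "form_at (fwedge22 (contract2 \<omega> w) \<psi>) (vector [e1, e2, e3, e4])
    = pairing \<psi> w * form_at \<omega> (vector [e1, e2, e3, e4])"
proof -
  \<comment> \<open>The 2-form \<open>(a, b) \<mapsto> \<Sum> \<plusminus> \<omega>(e\<^sub>i, e\<^sub>j, a, b) \<psi>(e\<^sub>k, e\<^sub>l)\<close>, which represents the left-hand side.\<close>
  define \<eta> where "\<eta> =
      form_at \<psi> (vector [e3, e4]) *\<^sub>R insert2 \<omega> (vector [e1, e2])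
    - form_at \<psi> (vector [e2, e4]) *\<^sub>R insert2 \<omega> (vector [e1, e3])
    + form_at \<psi> (vector [e2, e3]) *\<^sub>R insert2 \<omega> (vector [e1, e4])
    + form_at \<psi> (vector [e1, e4]) *\<^sub>R insert2 \<omega> (vector [e2, e3])
    - form_at \<psi> (vector [e1, e3]) *\<^sub>R insert2 \<omega> (vector [e2, e4])
    + form_at \<psi> (vector [e1, e2]) *\<^sub>R insert2 \<omega> (vector [e3, e4])"
  let ?v = "form_at \<omega> (vector [e1, e2, e3, e4])"
  note L = linear_pairing_left[of w]
  have "\<eta> - ?v *\<^sub>R \<psi> = 0"
  proof (rule kform_eq_0_if_basis[OF span])
    fix x :: "'a^2" assume x: "\<And>i. x $ i \<in> {e1, e2, e3, e4}"
    have *: "form_at (\<eta> - ?v *\<^sub>R \<psi>) (vector [a, b]) = 0"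
      if "a \<in> {e1, e2, e3, e4}" "b \<in> {e1, e2, e3, e4}" for a b
    proof -
      note sw2 = form2_swap[of \<psi> e1 e2] form2_swap[of \<psi> e1 e3] form2_swap[of \<psi> e1 e4]
        form2_swap[of \<psi> e2 e3] form2_swap[of \<psi> e2 e4] form2_swap[of \<psi> e3 e4]
      note sw4 = form4_swap(1)[of \<omega> e1 e2] form4_swap(1)[of \<omega> e1 e3] form4_swap(1)[of \<omega> e1 e4]
        form4_swap(1)[of \<omega> e2 e3] form4_swap(1)[of \<omega> e2 e4] form4_swap(1)[of \<omega> e3 e4]
        form4_swap(2)[of \<omega> _ e1 e2] form4_swap(2)[of \<omega> _ e1 e3] form4_swap(2)[of \<omega> _ e1 e4]
        form4_swap(2)[of \<omega> _ e2 e3] form4_swap(2)[of \<omega> _ e2 e4] form4_swap(2)[of \<omega> _ e3 e4]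
        form4_swap(3)[of \<omega> _ _ e1 e2] form4_swap(3)[of \<omega> _ _ e1 e3] form4_swap(3)[of \<omega> _ _ e1 e4]
        form4_swap(3)[of \<omega> _ _ e2 e3] form4_swap(3)[of \<omega> _ _ e2 e4] form4_swap(3)[of \<omega> _ _ e3 e4]
      show ?thesis
        using that unfolding \<eta>_def
        by (elim insertE emptyE)
          (simp_all add: form_at_simps form_at_insert2 form2_alt form4_alt sw2 sw4)
    qed
    show "form_at (\<eta> - ?v *\<^sub>R \<psi>) x = 0"
      using *[OF x x, of 1 2] by (simp only: vector_eta)
  qed
  then have "\<eta> = ?v *\<^sub>R \<psi>" by simp
  moreover have "form_at (fwedge22 (contract2 \<omega> w) \<psi>) (vector [e1, e2, e3, e4]) = pairing \<eta> w"
    unfolding \<eta>_def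
    by (simp add: form_at_fwedge22 form_at_contract2 linear_add[OF L] linear_diff[OF L]
        linear_cmul[OF L])
  ultimately show ?thesis by (simp add: linear_cmul[OF L])
qed

section \<open>Closed forms and boundaries\<close>

lemma subspace_boundaries: "subspace (boundaries br)"
proof -
  note R = linear_pairing_right
  show ?thesis
  proof (rule subspaceI)
    show "0 \<in> boundaries br"
      unfolding boundaries_def
      by (auto simp: linear_0[OF R] intro!: exI[of _ 0])
  next
    fix x y assume "x \<in> boundaries br" "y \<in> boundaries br"
    then obtain w z where "\<And>\<phi>. pairing \<phi> x = pairing (ce_d br \<phi>) w"
      "\<And>\<phi>. pairing \<phi> y = pairing (ce_d br \<phi>) z"
      unfolding boundaries_def by blast
    then show "x + y \<in> boundaries br"
      unfolding boundaries_def by (auto simp: linear_add[OF R] intro!: exI[of _ "w + z"])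
  next
    fix r x assume "x \<in> boundaries br"
    then obtain w where "\<And>\<phi>. pairing \<phi> x = pairing (ce_d br \<phi>) w"
      unfolding boundaries_def by blast
    then show "r *\<^sub>R x \<in> boundaries br"
      unfolding boundaries_def by (auto simp: linear_cmul[OF R] intro!: exI[of _ "r *\<^sub>R w"])
  qed
qed

text \<open>The value of \<open>d\<psi>\<close> on three vectors is itself the pairing of \<open>\<psi>\<close> with a boundary, namely that
  of their wedge product.\<close>

lemma closed_iff_annihilates_boundaries:
  fixes br :: "'a::real_vector \<Rightarrow> 'a \<Rightarrow> 'a"
  assumes "dim (UNIV :: 'a set) = 4" "lie_bracket br"
  shows "ce_d br \<psi> = 0 \<longleftrightarrow> (\<forall>u\<in>boundaries br. pairing \<psi> u = 0)"
proof
  assume "ce_d br \<psi> = 0"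
  then show "\<forall>u\<in>boundaries br. pairing \<psi> u = 0"
    by (auto simp: boundaries_def linear_0[OF linear_pairing_left])
next
  assume ann: "\<forall>u\<in>boundaries br. pairing \<psi> u = 0"
  have lin: "linear (ce_d br)"
    using ce_d_eq(1)[OF assms] by (auto simp: ce_differential_def)
  show "ce_d br \<psi> = 0"
  proof (rule kform_eqI)
    fix x :: "'a^3"
    define u where "u = Abs_kvector (\<lambda>\<phi>. pairing (ce_d br \<phi>) (decomposable x))"
    have "linear (\<lambda>\<phi>. pairing (ce_d br \<phi>) (decomposable x))"
      using linear_compose[OF lin linear_pairing_left] by (simp add: o_def)
    then have u: "pairing \<phi> u = pairing (ce_d br \<phi>) (decomposable x)" for \<phi>
      by (simp add: pairing_def u_def Abs_kvector_inverse)
    then have "u \<in> boundaries br" by (auto simp: boundaries_def)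
    then show "form_at (ce_d br \<psi>) x = form_at 0 x"
      using ann u[of \<psi>] by (simp add: pairing_decomposable form_at_simps)
  qed
qed

section \<open>Invariant and anti-invariant 2-forms\<close>

definition pullback2 :: "('a::real_vector \<Rightarrow> 'a) \<Rightarrow> ('a, 2) kform \<Rightarrow> ('a, 2) kform" where
  "pullback2 J \<alpha> = Abs_kform (\<lambda>x. form_at \<alpha> (vector [J (x $ 1), J (x $ 2)]))"

lemma form_at_pullback2:
  assumes "linear J"
  shows "form_at (pullback2 J \<alpha>) (vector [a, b]) = form_at \<alpha> (vector [J a, J b])"
proof -
  have "alternating_form (\<lambda>x :: 'a^2. (\<lambda>a b. form_at \<alpha> (vector [J a, J b])) (x $ 1) (x $ 2))"
    using assms by (intro alternating_form_2I) (auto simp: linear_iff form2_simps)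
  then show ?thesis by (simp add: pullback2_def Abs_kform_inverse)
qed

definition inv_part :: "('a::real_vector \<Rightarrow> 'a) \<Rightarrow> ('a, 2) kform \<Rightarrow> ('a, 2) kform" where
  "inv_part J \<alpha> = (1/2) *\<^sub>R (\<alpha> + pullback2 J \<alpha>)"

definition anti_part :: "('a::real_vector \<Rightarrow> 'a) \<Rightarrow> ('a, 2) kform \<Rightarrow> ('a, 2) kform" where
  "anti_part J \<alpha> = (1/2) *\<^sub>R (\<alpha> - pullback2 J \<alpha>)"

definition Lambda_minus :: "('a::real_vector \<Rightarrow> 'a) \<Rightarrow> ('a, 2) kform set" where
  "Lambda_minus J =
     {\<alpha>. \<forall>u v. form_at \<alpha> (vector [J u, J v]) = - form_at \<alpha> (vector [u, v])}"

lemma Lambda_plus_simps: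
  assumes "\<alpha> \<in> Lambda_plus J" "\<And>v. J (J v) = - v"
  shows "form_at \<alpha> (vector [J u, J v]) = form_at \<alpha> (vector [u, v])"
    "form_at \<alpha> (vector [J u, v]) = - form_at \<alpha> (vector [u, J v])"
proof -
  show 1: "form_at \<alpha> (vector [J u, J v]) = form_at \<alpha> (vector [u, v])" for u v
    using assms(1) by (simp add: Lambda_plus_def)
  show "form_at \<alpha> (vector [J u, v]) = - form_at \<alpha> (vector [u, J v])"
    using 1[of u "J v"] by (simp add: assms(2) form2_simps)
qed

lemma Lambda_minus_simps:
  assumes "\<alpha> \<in> Lambda_minus J" "\<And>v. J (J v) = - v"
  shows "form_at \<alpha> (vector [J u, J v]) = - form_at \<alpha> (vector [u, v])"
    "form_at \<alpha> (vector [J u, v]) = form_at \<alpha> (vector [u, J v])"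
    "form_at \<alpha> (vector [u, J u]) = 0"
proof -
  show 1: "form_at \<alpha> (vector [J u, J v]) = - form_at \<alpha> (vector [u, v])" for u v
    using assms(1) by (simp add: Lambda_minus_def)
  show 2: "form_at \<alpha> (vector [J u, v]) = form_at \<alpha> (vector [u, J v])" for v
    using 1[of u "J v"] by (simp add: assms(2) form2_simps)
  show "form_at \<alpha> (vector [u, J u]) = 0"
    using 2[of u] form2_swap[of \<alpha> "J u" u] by simp
qed

section \<open>The wedge form in a complex frame\<close>

text \<open>The vectors \<open>e, f\<close> are a complex basis of \<open>(V, J)\<close>.\<close>

locale complex_frame =
  fixes J :: "'a::real_vector \<Rightarrow> 'a" and e f :: 'a
  assumes linear_J: "linear J" and J_J: "J (J v) = - v"
    and spans: "span {e, J e, f, J f} = UNIV" and f_notin: "f \<notin> span {e, J e}"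
    and e_nz: "e \<noteq> 0"
begin

lemmas plus_simps = Lambda_plus_simps[OF _ J_J]
lemmas minus_simps = Lambda_minus_simps[OF _ J_J]

definition q :: "('a, 2) kform \<Rightarrow> ('a, 2) kform \<Rightarrow> real" where
  "q \<alpha> \<beta> = form_at (fwedge22 \<alpha> \<beta>) (vector [e, J e, f, J f])"

lemma bilinear_q: "bilinear q"
  unfolding q_def by (rule bilinear_fwedge22_at)

lemma q_commute: "q \<alpha> \<beta> = q \<beta> \<alpha>"
  by (simp add: q_def fwedge22_commute)

lemma inv_part_plus: "inv_part J \<alpha> \<in> Lambda_plus J"
  by (auto simp: Lambda_plus_def inv_part_def form_at_simps form_at_pullback2[OF linear_J] J_J
      form2_simps)

lemma anti_part_minus: "anti_part J \<alpha> \<in> Lambda_minus J"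
  by (auto simp: Lambda_minus_def anti_part_def form_at_simps form_at_pullback2[OF linear_J] J_J
      form2_simps field_simps)

lemma inv_anti: "\<alpha> = inv_part J \<alpha> + anti_part J \<alpha>"
  by (intro kform_eqI) (simp add: inv_part_def anti_part_def form_at_simps field_simps)

lemma linear_inv_part: "linear (inv_part J)"
proof -
  have "form_at (pullback2 J (\<alpha> + \<beta>)) x = form_at (pullback2 J \<alpha> + pullback2 J \<beta>) x"
    "form_at (pullback2 J (r *\<^sub>R \<alpha>)) x = form_at (r *\<^sub>R pullback2 J \<alpha>) x" for \<alpha> \<beta> x r
    using form_at_pullback2[OF linear_J, of _ "x $ 1" "x $ 2"]
    by (simp_all only: vector_eta form_at_simps)
  then show ?thesis
    by (auto simp: linear_iff inv_part_def form_at_simps algebra_simps intro!: kform_eqI)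
qed

text \<open>An invariant form has the Hermitian matrix with diagonal entries \<open>\<alpha>(e, J e)\<close>, \<open>\<alpha>(f, J f)\<close> and
  off-diagonal entry of real part \<open>\<alpha>(e, J f)\<close> and imaginary part \<open>\<plusminus> \<alpha>(e, f)\<close>; \<open>q\<close> is the
  polarisation of twice its determinant, a Lorentz form.\<close>

lemma q_plus:
  assumes "\<alpha> \<in> Lambda_plus J" "\<beta> \<in> Lambda_plus J"
  shows "q \<alpha> \<beta> =
      form_at \<alpha> (vector [e, J e]) * form_at \<beta> (vector [f, J f])
    + form_at \<alpha> (vector [f, J f]) * form_at \<beta> (vector [e, J e])
    - 2 * (form_at \<alpha> (vector [e, f]) * form_at \<beta> (vector [e, f])
    + form_at \<alpha> (vector [e, J f]) * form_at \<beta> (vector [e, J f]))"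
  by (simp add: q_def form_at_fwedge22 plus_simps[OF assms(1)] plus_simps[OF assms(2)] J_J form2_simps)

lemma q_minus:
  assumes "\<alpha> \<in> Lambda_minus J"
  shows "q \<alpha> \<alpha> = 2 * ((form_at \<alpha> (vector [e, f]))\<^sup>2 + (form_at \<alpha> (vector [e, J f]))\<^sup>2)"
  by (simp add: q_def form_at_fwedge22 minus_simps[OF assms] power2_eq_square J_J form2_simps)

lemma q_plus_minus:
  assumes "\<alpha> \<in> Lambda_plus J" "\<beta> \<in> Lambda_minus J"
  shows "q \<alpha> \<beta> = 0"
  by (simp add: q_def form_at_fwedge22 plus_simps[OF assms(1)] minus_simps[OF assms(2)] J_J form2_simps)

lemma form_eq_0_if_frame:
  fixes \<alpha> :: "('a, 2) kform"
  assumes "form_at \<alpha> (vector [e, J e]) = 0" "form_at \<alpha> (vector [e, f]) = 0"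
    "form_at \<alpha> (vector [e, J f]) = 0" "form_at \<alpha> (vector [J e, f]) = 0"
    "form_at \<alpha> (vector [J e, J f]) = 0" "form_at \<alpha> (vector [f, J f]) = 0"
  shows "\<alpha> = 0"
proof (rule kform_eq_0_if_basis[OF spans])
  fix x :: "'a^2" assume x: "\<And>i. x $ i \<in> {e, J e, f, J f}"
  have "form_at \<alpha> (vector [a, b]) = 0"
    if "a \<in> {e, J e, f, J f}" "b \<in> {e, J e, f, J f}" for a b
  proof -
    note form2_swap[of \<alpha> e "J e"] form2_swap[of \<alpha> e f] form2_swap[of \<alpha> e "J f"]
      form2_swap[of \<alpha> "J e" f] form2_swap[of \<alpha> "J e" "J f"] form2_swap[of \<alpha> f "J f"]
    then show ?thesis using that assms by (auto simp: form2_alt)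
  qed
  from this[OF x x, of 1 2] show "form_at \<alpha> x = 0" by (simp only: vector_eta)
qed

lemma subspace_finitely_spanned:
  fixes C :: "('a, 2) kform set"
  assumes "subspace C"
  obtains S where "finite S" "span S = C"
proof -
  define h where "h \<alpha> = (form_at \<alpha> (vector [e, J e]), form_at \<alpha> (vector [e, f]),
    form_at \<alpha> (vector [e, J f]), form_at \<alpha> (vector [J e, f]),
    form_at \<alpha> (vector [J e, J f]), form_at \<alpha> (vector [f, J f]))" for \<alpha> :: "('a, 2) kform"
  have lin: "linear h" by (auto simp: linear_iff h_def form_at_simps)
  have "inj h"
    unfolding linear_injective_0[OF lin]
    by (auto simp: h_def zero_prod_def intro: form_eq_0_if_frame)
  show ?thesis by (rule finite_basis_if_injective[OF lin \<open>inj h\<close> assms]) (rule that)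
qed

lemma q_minus_pos:
  assumes "\<alpha> \<in> Lambda_minus J"
  shows "q \<alpha> \<alpha> \<ge> 0" and "q \<alpha> \<alpha> = 0 \<Longrightarrow> \<alpha> = 0"
proof -
  show "q \<alpha> \<alpha> \<ge> 0" by (simp add: q_minus[OF assms])
  assume "q \<alpha> \<alpha> = 0"
  then have "form_at \<alpha> (vector [e, f]) = 0" "form_at \<alpha> (vector [e, J f]) = 0"
    unfolding q_minus[OF assms] by (simp_all del: distrib_left_numeral)
  then show "\<alpha> = 0"
    by (intro form_eq_0_if_frame) (simp_all add: minus_simps[OF assms] J_J form2_simps)
qed

text \<open>The reverse Cauchy--Schwarz inequality of a Lorentz form: the orthogonal complement of a vector
  of positive square is negative definite.\<close>

lemma plus_eq_0_if_orthogonal: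
  assumes \<alpha>: "\<alpha> \<in> Lambda_plus J" and \<beta>: "\<beta> \<in> Lambda_plus J"
    and "q \<alpha> \<alpha> > 0" "q \<alpha> \<beta> = 0" "q \<beta> \<beta> \<ge> 0"
  shows "\<beta> = 0"
proof -
  define a b r s where ab: "a = form_at \<alpha> (vector [e, J e])" "b = form_at \<alpha> (vector [f, J f])"
    "r = form_at \<alpha> (vector [e, f])" "s = form_at \<alpha> (vector [e, J f])"
  define x y t u where xy: "x = form_at \<beta> (vector [e, J e])" "y = form_at \<beta> (vector [f, J f])"
    "t = form_at \<beta> (vector [e, f])" "u = form_at \<beta> (vector [e, J f])"
  have 1: "a * b > r\<^sup>2 + s\<^sup>2" "x * y \<ge> t\<^sup>2 + u\<^sup>2" "a * y + b * x = 2 * (r * t + s * u)"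
    using assms(3-5) q_plus[OF \<alpha> \<alpha>] q_plus[OF \<alpha> \<beta>] q_plus[OF \<beta> \<beta>]
    by (simp_all add: ab xy power2_eq_square algebra_simps)
  have pos: "a * b > 0"
    using 1(1) by (smt (verit) zero_le_power2)
  \<comment> \<open>AM--GM bounds \<open>(a y + b x)\<^sup>2\<close> from below by \<open>4 a b (t\<^sup>2 + u\<^sup>2)\<close>, Cauchy--Schwarz from above by
    \<open>4 (r\<^sup>2 + s\<^sup>2) (t\<^sup>2 + u\<^sup>2)\<close>, and \<open>a b > r\<^sup>2 + s\<^sup>2\<close>.\<close>
  have "(a * y + b * x)\<^sup>2 = (a * y - b * x)\<^sup>2 + 4 * ((a * b) * (x * y))"
    by (simp add: power2_eq_square algebra_simps)
  then have "(a * y + b * x)\<^sup>2 \<ge> 4 * ((a * b) * (t\<^sup>2 + u\<^sup>2))"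
    using mult_left_mono[OF 1(2), of "a * b"] pos by (smt (verit) zero_le_power2)
  moreover have "(r * t + s * u)\<^sup>2 + (r * u - s * t)\<^sup>2 = (r\<^sup>2 + s\<^sup>2) * (t\<^sup>2 + u\<^sup>2)"
    by (simp add: power2_eq_square algebra_simps)
  moreover have "(a * y + b * x)\<^sup>2 = 4 * (r * t + s * u)\<^sup>2"
    unfolding 1(3) power_mult_distrib by simp
  ultimately have "(a * b) * (t\<^sup>2 + u\<^sup>2) \<le> (r\<^sup>2 + s\<^sup>2) * (t\<^sup>2 + u\<^sup>2)"
    using zero_le_power2[of "r * u - s * t"] by linarith
  then have "t\<^sup>2 + u\<^sup>2 = 0"
    using 1(1) by (smt (verit) mult_strict_right_mono sum_power2_ge_zero)
  then have tu: "t = 0" "u = 0" by (simp_all add: sum_power2_eq_zero_iff)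
  have sum: "a * y = - (b * x)" using 1(3) tu by simp
  have "(a * b) * (x * y) = - (b * x)\<^sup>2"
    using sum by (metis (no_types, lifting) minus_mult_right mult.assoc mult.commute power2_eq_square)
  moreover have "(a * b) * (x * y) \<ge> 0" using pos 1(2) tu by simp
  ultimately have "b * x = 0" by (smt (verit) zero_le_power2 power2_eq_square mult_eq_0_iff)
  then have "x = 0" "y = 0" using sum pos by auto
  with tu have 0: "form_at \<beta> (vector [e, J e]) = 0" "form_at \<beta> (vector [f, J f]) = 0"
    "form_at \<beta> (vector [e, f]) = 0" "form_at \<beta> (vector [e, J f]) = 0"
    by (simp_all add: xy)
  moreover have "form_at \<beta> (vector [J e, f]) = 0" "form_at \<beta> (vector [J e, J f]) = 0"
    using 0 plus_simps[OF \<beta>, of e f] by simp_all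
  ultimately show ?thesis by (intro form_eq_0_if_frame)
qed

text \<open>Completing the square in the Hermitian form \<open>v \<mapsto> \<alpha>(v, J v)\<close>. This is Sylvester's criterion in
  both directions: \<open>\<alpha>\<close> is positive if and only if \<open>\<alpha>(e, J e) > 0\<close> and \<open>q \<alpha> \<alpha> > 0\<close>.\<close>

lemma hermitian_square:
  assumes "\<alpha> \<in> Lambda_plus J"
  defines "a \<equiv> form_at \<alpha> (vector [e, J e])" and "r \<equiv> form_at \<alpha> (vector [e, f])"
    and "s \<equiv> form_at \<alpha> (vector [e, J f])"
  assumes v: "v = x *\<^sub>R e + y *\<^sub>R J e + z *\<^sub>R f + w *\<^sub>R J f"
  shows "a * form_at \<alpha> (vector [v, J v])
    = (a * x + s * z - r * w)\<^sup>2 + (a * y + r * z + s * w)\<^sup>2 + q \<alpha> \<alpha> / 2 * (z\<^sup>2 + w\<^sup>2)"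
proof -
  have Jv: "J v = x *\<^sub>R J e - y *\<^sub>R e + z *\<^sub>R J f - w *\<^sub>R f"
    by (simp add: v linear_add[OF linear_J] linear_cmul[OF linear_J] J_J)
  have fe: "form_at \<alpha> (vector [f, e]) = - form_at \<alpha> (vector [e, f])"
    "form_at \<alpha> (vector [f, J e]) = form_at \<alpha> (vector [e, J f])"
    using form2_swap[of \<alpha> e f] form2_swap[of \<alpha> "J e" f] plus_simps(2)[OF assms(1), of e f]
    by simp_all
  have half: "q \<alpha> \<alpha> / 2 = a * form_at \<alpha> (vector [f, J f]) - (r * r + s * s)"
    unfolding q_plus[OF assms(1,1)] a_def r_def s_def by (simp add: field_simps)
  show ?thesis
    unfolding Jv half a_def r_def s_def unfolding v
    by (simp add: form2_simps linear_diff[OF form2_linear(2)] plus_simps[OF assms(1)] fe J_J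
        power2_eq_square algebra_simps)
qed

lemma frame_coordinates:
  obtains x y z w where "v = x *\<^sub>R e + y *\<^sub>R J e + z *\<^sub>R f + w *\<^sub>R J f"
proof -
  have "v \<in> span {e, J e, f, J f}" by (simp add: spans)
  then obtain x y z w where
    "v - x *\<^sub>R e - y *\<^sub>R J e - z *\<^sub>R f - w *\<^sub>R J f = 0"
    by (auto simp: span_insert)
  then have "v = x *\<^sub>R e + y *\<^sub>R J e + z *\<^sub>R f + w *\<^sub>R J f" by (simp add: algebra_simps)
  then show ?thesis by (rule that)
qed

lemma positive_if_q_pos:
  assumes "\<alpha> \<in> Lambda_plus J" "q \<alpha> \<alpha> > 0" "form_at \<alpha> (vector [e, J e]) > 0" "v \<noteq> 0"
  shows "form_at \<alpha> (vector [v, J v]) > 0"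
proof -
  obtain x y z w where v: "v = x *\<^sub>R e + y *\<^sub>R J e + z *\<^sub>R f + w *\<^sub>R J f"
    by (rule frame_coordinates)
  let ?a = "form_at \<alpha> (vector [e, J e])"
  note sq = hermitian_square[OF assms(1) v]
  have "?a * form_at \<alpha> (vector [v, J v]) > 0"
  proof (cases "z = 0 \<and> w = 0")
    case True
    then have "x \<noteq> 0 \<or> y \<noteq> 0" using assms(4) v by auto
    then show ?thesis unfolding sq using True assms(3)
      by (auto simp: sum_power2_gt_zero_iff)
  next
    case False
    then have "q \<alpha> \<alpha> / 2 * (z\<^sup>2 + w\<^sup>2) > 0"
      using assms(2) by (simp add: sum_power2_gt_zero_iff)
    then show ?thesis unfolding sq by (simp add: add_nonneg_pos)
  qed
  then show ?thesis using assms(3) by (simp add: zero_less_mult_iff)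
qed

lemma q_pos_if_positive:
  assumes "\<alpha> \<in> Lambda_plus J" "\<And>v. v \<noteq> 0 \<Longrightarrow> form_at \<alpha> (vector [v, J v]) > 0"
  shows "q \<alpha> \<alpha> > 0"
proof -
  define a r s where ars: "a = form_at \<alpha> (vector [e, J e])" "r = form_at \<alpha> (vector [e, f])"
    "s = form_at \<alpha> (vector [e, J f])"
  have a: "a > 0" using assms(2)[OF e_nz] by (simp add: ars)
  \<comment> \<open>The vector at which both squares in \<open>hermitian_square\<close> vanish, leaving \<open>q \<alpha> \<alpha> / 2\<close>.\<close>
  define v where "v = (- s / a) *\<^sub>R e + (- r / a) *\<^sub>R J e + 1 *\<^sub>R f + 0 *\<^sub>R J f"
  have "v \<noteq> 0"
  proof
    assume "v = 0"
    then have "f = (s / a) *\<^sub>R e + (r / a) *\<^sub>R J e" by (simp add: v_def algebra_simps)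
    also have "\<dots> \<in> span {e, J e}" by (intro span_add span_scale span_base) auto
    finally show False using f_notin by simp
  qed
  then have "a * form_at \<alpha> (vector [v, J v]) > 0" using assms(2) a by simp
  then show ?thesis
    using hermitian_square[OF assms(1) v_def] a by (simp add: ars[symmetric])
qed

lemma compatible_if_tamed:
  fixes br :: "'a \<Rightarrow> 'a \<Rightarrow> 'a"
  assumes lie: "lie_bracket br" and dim: "dim (UNIV :: 'a set) = 4"
    and iso: "\<And>u. u \<in> boundaries br \<Longrightarrow> wedge22 u u = 0"
    and \<phi>: "tamed_form br J \<phi>"
  shows "\<exists>\<psi>. compatible_form br J \<psi>"
proof -
  note closed_iff = closed_iff_annihilates_boundaries[OF dim lie]
  note bil = bilinear_ladd[OF bilinear_q] bilinear_radd[OF bilinear_q] bilinear_lsub[OF bilinear_q]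
    bilinear_rsub[OF bilinear_q] bilinear_lmul[OF bilinear_q] bilinear_rmul[OF bilinear_q]
  have q_inv: "q \<alpha> \<beta> = q (inv_part J \<alpha>) \<beta>" if "\<beta> \<in> Lambda_plus J" for \<alpha> \<beta>
  proof -
    have "q \<alpha> \<beta> = q (inv_part J \<alpha> + anti_part J \<alpha>) \<beta>" using inv_anti[of \<alpha>] by simp
    then show ?thesis
      using q_plus_minus[OF that anti_part_minus] by (simp add: bil q_commute[of "anti_part J \<alpha>"])
  qed
  have q_split: "q \<alpha> \<alpha> = q (inv_part J \<alpha>) (inv_part J \<alpha>) + q (anti_part J \<alpha>) (anti_part J \<alpha>)"
    for \<alpha>
  proof -
    have "q \<alpha> \<alpha> = q (inv_part J \<alpha> + anti_part J \<alpha>) (inv_part J \<alpha> + anti_part J \<alpha>)"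
      using inv_anti[of \<alpha>] by simp
    then show ?thesis
      using q_plus_minus[OF inv_part_plus anti_part_minus]
      by (simp add: bil q_commute[of "anti_part J \<alpha>" "inv_part J _"])
  qed
  have \<phi>_closed: "ce_d br \<phi> = 0" and \<phi>_pos: "\<And>v. v \<noteq> 0 \<Longrightarrow> form_at \<phi> (vector [v, J v]) > 0"
    using \<phi> by (auto simp: tamed_form_def pairing_decomposable)
  have "form_at (inv_part J \<phi>) (vector [v, J v]) = form_at \<phi> (vector [v, J v])" for v
    using form2_swap[of \<phi> v "J v"]
    by (simp add: inv_part_def form_at_simps form_at_pullback2[OF linear_J] J_J form2_simps)
  then have pos: "q (inv_part J \<phi>) (inv_part J \<phi>) > 0"
    using \<phi>_pos by (intro q_pos_if_positive inv_part_plus) simp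
  \<comment> \<open>A taming form is nondegenerate, so its square serves as the volume form.\<close>
  define \<omega> where "\<omega> = fwedge22 \<phi> \<phi>"
  define vol where "vol = form_at \<omega> (vector [e, J e, f, J f])"
  have vol: "vol > 0"
    using pos q_split[of \<phi>] q_minus_pos(1)[OF anti_part_minus, of \<phi>]
    by (simp add: vol_def \<omega>_def q_def)
  have star: "q (contract2 \<omega> u) \<psi> = pairing \<psi> u * vol" for u \<psi>
    unfolding q_def vol_def by (rule fwedge22_contract2[OF spans])
  have null: "q (contract2 \<omega> u) (contract2 \<omega> u) = 0" if "u \<in> boundaries br" for u
    using iso[OF that] pairing_wedge22[of \<omega> u u]
    by (simp add: star linear_0[OF linear_pairing_right])
  \<comment> \<open>An invariant form is closed if it is orthogonal to \<open>C\<close>; see \<open>q_inv\<close> and \<open>star\<close>.\<close>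
  define C where "C = (\<lambda>u. inv_part J (contract2 \<omega> u)) ` boundaries br"
  have "linear (contract2 \<omega>)"
    by (auto simp: linear_iff form_at_contract2 form_at_simps linear_add[OF linear_pairing_right]
        linear_cmul[OF linear_pairing_right] intro!: kform_eqI)
  then have "subspace C"
    unfolding C_def using linear_compose[OF _ linear_inv_part, of "contract2 \<omega>"]
    by (intro linear_subspace_image subspace_boundaries) (auto simp: o_def)
  then obtain S where S: "finite S" "span S = C" by (rule subspace_finitely_spanned)
  have neg: "q c c \<le> 0" "q c c = 0 \<Longrightarrow> c = 0" if "c \<in> C" for c
  proof -
    obtain u where u: "u \<in> boundaries br" "c = inv_part J (contract2 \<omega> u)"
      using \<open>c \<in> C\<close> by (auto simp: C_def)
    define n where "n = anti_part J (contract2 \<omega> u)"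
    have n: "n \<in> Lambda_minus J" unfolding n_def by (rule anti_part_minus)
    have sum: "q c c + q n n = 0" using null[OF u(1)] q_split[of "contract2 \<omega> u"] u(2) n_def by simp
    then show "q c c \<le> 0" using q_minus_pos(1)[OF n] by simp
    assume 0: "q c c = 0"
    then have "n = 0" using sum q_minus_pos(2)[OF n] by simp
    then have c: "contract2 \<omega> u = c" using inv_anti[of "contract2 \<omega> u"] u(2) n_def by simp
    have c_plus: "c \<in> Lambda_plus J" unfolding u(2) by (rule inv_part_plus)
    have "q \<phi> c = 0"
      using star[of u \<phi>] \<phi>_closed u(1) closed_iff c by (simp add: q_commute)
    then have "q (inv_part J \<phi>) c = 0" using q_inv[OF c_plus] by simp
    then show "c = 0"
      using plus_eq_0_if_orthogonal[OF inv_part_plus c_plus pos] 0 by simp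
  qed
  obtain c where c: "c \<in> C" "\<And>d. d \<in> C \<Longrightarrow> q (inv_part J \<phi> - c) d = 0"
    using anisotropic_projection[OF bilinear_q S(1), of "inv_part J \<phi>"] neg(2) S(2)
    by blast
  define \<tau> where "\<tau> = inv_part J \<phi> - c"
  have \<tau>_plus: "\<tau> \<in> Lambda_plus J"
  proof -
    have "c \<in> Lambda_plus J" using c(1) inv_part_plus by (auto simp: C_def)
    then show ?thesis
      using inv_part_plus[of \<phi>] by (simp add: \<tau>_def Lambda_plus_def form_at_simps)
  qed
  have \<tau>_closed: "pairing \<tau> u = 0" if "u \<in> boundaries br" for u
  proof -
    have "q (contract2 \<omega> u) \<tau> = q (inv_part J (contract2 \<omega> u)) \<tau>" by (rule q_inv[OF \<tau>_plus])
    also have "\<dots> = 0" using c(2) that by (subst q_commute) (auto simp: \<tau>_def C_def)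
    finally show ?thesis using star[of u \<tau>] vol by simp
  qed
  have "q (inv_part J \<phi>) (inv_part J \<phi>) = q (\<tau> + c) (\<tau> + c)" by (simp add: \<tau>_def)
  also have "\<dots> = q \<tau> \<tau> + q c c"
    using c(2)[OF c(1)] unfolding \<tau>_def[symmetric] by (simp add: bil q_commute[of c \<tau>])
  finally have \<tau>_pos: "q \<tau> \<tau> > 0" using pos neg(1)[OF c(1)] by linarith
  have "form_at \<tau> (vector [e, J e]) * form_at \<tau> (vector [f, J f]) > 0"
    using \<tau>_pos q_plus[OF \<tau>_plus \<tau>_plus]
    by (smt (verit) mult.commute zero_le_square)
  then have nz: "form_at \<tau> (vector [e, J e]) \<noteq> 0" by auto
  \<comment> \<open>The projection leaves undetermined in which half of the cone \<open>\<tau>\<close> lies.\<close>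
  define \<psi> where "\<psi> = sgn (form_at \<tau> (vector [e, J e])) *\<^sub>R \<tau>"
  have "\<psi> \<in> Lambda_plus J" using \<tau>_plus by (simp add: \<psi>_def Lambda_plus_def form_at_simps)
  moreover have "q \<psi> \<psi> > 0" using \<tau>_pos nz by (simp add: \<psi>_def bil sgn_if)
  moreover have "form_at \<psi> (vector [e, J e]) > 0" using nz by (simp add: \<psi>_def form_at_simps sgn_if)
  moreover have "ce_d br \<psi> = 0"
    unfolding closed_iff using \<tau>_closed by (simp add: \<psi>_def linear_cmul[OF linear_pairing_left])
  ultimately have "compatible_form br J \<psi>"
    using positive_if_q_pos by (auto simp: compatible_form_def tamed_form_def pairing_decomposable)
  then show ?thesis by blast
qed

end

text \<open>The frame is built in two steps, each from a vector \<open>x\<close> outside a \<open>J\<close>-invariant subspace: \<open>J x\<close> is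
  then independent of that subspace and \<open>x\<close>, because \<open>J\<close> has no real eigenvalue on the quotient.\<close>

lemma complex_frame_exists:
  fixes J :: "'a::real_vector \<Rightarrow> 'a"
  assumes J: "linear J" "\<And>v. J (J v) = - v" and dim: "dim (UNIV :: 'a set) = 4"
  obtains e f where "complex_frame J e f"
proof -
  obtain B :: "'a set" where B: "finite B" "card B = 4" "independent B" "span B = UNIV"
    by (rule dim_4_basis[OF dim])
  have small: "\<exists>x. x \<notin> span T" if "finite T" "card T < 4" for T :: "'a set"
  proof (rule ccontr)
    assume "\<nexists>x. x \<notin> span T"
    then have "B \<subseteq> span T" by blast
    then have "card B \<le> card T" using independent_span_bound[OF that(1) B(3)] by simp
    then show False using B(2) that(2) by simp
  qed
  obtain e :: 'a where e: "e \<notin> span {}" using small[of "{}"] by auto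
  then have e0: "e \<noteq> 0" by simp
  \<comment> \<open>From \<open>J x \<equiv> k x\<close> modulo a \<open>J\<close>-invariant subspace, \<open>J\<^sup>2 = -1\<close> gives \<open>(1 + k\<^sup>2) x \<equiv> 0\<close>.\<close>
  have step: "J x \<notin> span (insert x T)" if T: "J ` span T \<subseteq> span T" and x: "x \<notin> span T" for x T
  proof
    assume "J x \<in> span (insert x T)"
    then obtain k where k: "J x - k *\<^sub>R x \<in> span T" by (auto simp: span_insert)
    then have "J (J x - k *\<^sub>R x) \<in> span T" using T by blast
    then have "- x - k *\<^sub>R J x \<in> span T"
      by (simp add: linear_diff[OF J(1)] linear_cmul[OF J(1)] J(2))
    then have "(- x - k *\<^sub>R J x) + k *\<^sub>R (J x - k *\<^sub>R x) \<in> span T"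
      using k by (intro span_add span_scale)
    then have "- (1 + k * k) *\<^sub>R x \<in> span T" by (simp add: algebra_simps)
    then have "(- inverse (1 + k * k)) *\<^sub>R (- (1 + k * k) *\<^sub>R x) \<in> span T"
      by (rule span_scale)
    moreover have "- inverse (1 + k * k) * - (1 + k * k) = 1"
      using zero_le_square[of k] by (simp only: minus_mult_minus) (rule left_inverse, linarith)
    ultimately show False using x by (simp only: scaleR_scaleR scaleR_one)
  qed
  have Je: "J e \<notin> span {e}" using step[of "{}" e] e linear_0[OF J(1)] by simp
  have "card {e, J e} < 4" by (simp add: card_insert_if)
  then obtain f where f: "f \<notin> span {e, J e}" using small[of "{e, J e}"] by auto
  have "J ` span {e, J e} = span {J e, - e}"
    by (simp add: linear_span_image[OF J(1), symmetric] J(2))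
  also have "\<dots> \<subseteq> span {e, J e}"
    by (rule span_minimal) (auto intro: span_base span_neg)
  finally have "J f \<notin> span {f, e, J e}" by (rule step[OF _ f])
  then have notin: "J f \<notin> span {f, J e, e}" "f \<notin> span {J e, e}"
    using f insert_commute[of e "J e" "{}"] by simp_all
  have ind: "independent {J f, f, J e, e}"
    using notin Je e0 by (intro independent_insertI independent_empty) simp_all
  have "J f \<notin> {f, J e, e}" "f \<notin> {J e, e}" "J e \<notin> {e}"
    using notin Je span_base[of "J f" "{f, J e, e}"] span_base[of f "{J e, e}"]
      span_base[of "J e" "{e}"] by argo+
  then have card: "card {J f, f, J e, e} = 4" by simp
  have "x \<in> span {J f, f, J e, e}" for x
  proof (rule ccontr)
    assume "x \<notin> span {J f, f, J e, e}"
    then have "independent (insert x {J f, f, J e, e})"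
      by (rule independent_insertI[OF _ ind])
    moreover have "x \<notin> {J f, f, J e, e}" using \<open>x \<notin> span _\<close> span_base[of x "{J f, f, J e, e}"] by argo
    ultimately show False
      using independent_span_bound[OF B(1), of "insert x {J f, f, J e, e}"] B(2,4) card by simp
  qed
  then have "span {J f, f, J e, e} = UNIV" by blast
  moreover have "{J f, f, J e, e} = {e, J e, f, J f}" by blast
  ultimately have "span {e, J e, f, J f} = UNIV" by (simp only:)
  then show ?thesis using J f e0 by (intro that[of e f] complex_frame.intro)
qed

theorem theorem0p2:
  fixes br :: "'a::real_vector \<Rightarrow> 'a \<Rightarrow> 'a" and J :: "'a \<Rightarrow> 'a"
  assumes "lie_bracket br"
    and "dim (UNIV :: 'a set) = 4"
    and "\<And>u w. u \<in> boundaries br \<Longrightarrow> w \<in> boundaries br \<Longrightarrow> wedge22 u w = 0"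
    and "almost_complex J"
  shows "tamed br J \<longleftrightarrow> almost_kaehler br J"
proof
  assume "tamed br J"
  then obtain \<phi> where \<phi>: "tamed_form br J \<phi>" by (auto simp: tamed_def)
  have J: "linear J" "\<And>v. J (J v) = - v"
    using assms(4) by (simp_all add: almost_complex_def)
  obtain e f where "complex_frame J e f"
    by (rule complex_frame_exists[OF J assms(2)])
  then interpret complex_frame J e f .
  show "almost_kaehler br J"
    unfolding almost_kaehler_def using compatible_if_tamed[OF assms(1,2) _ \<phi>] assms(3) by blast
next
  assume "almost_kaehler br J"
  then show "tamed br J" by (auto simp: almost_kaehler_def tamed_def compatible_form_def)
qed

end
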